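(* Let $t\ge0$, $n,l$ be nonnegative integers, and write $t=3u$, $3u+1$ or $3u+2$ with $u\ge0$ an integer. Then \[ \mathcal{M}(P_t\vee S_{1,n}\vee S_{1,l})\simeq \begin{cases} * & (t=3u),\\ S^{n+l+2u+1} & (t=3u+1),\\ S^{n+l+2u+2} & (t=3u+2), \end{cases} \] where $*$ denotes a point.
   Context: Graphs are regarded as $1$-dimensional simplicial complexes (simplices: vertices and edges). A discrete vector field $V$ on a graph $G$ is a set of pairs $(v,e)$ with $v$ a vertex and $e$ an edge containing $v$, such that every vertex and every edge of $G$ occurs in at most one pair of $V$. A $V$-path is a sequence $v_0,e_0,v_1,e_1,\dots,e_{k-1},v_k$ with $(v_i,e_i)\in V$ and $v_{i+1}\neq v_i$ the other endpoint of $e_i$; it is closed if $v_k=v_0$ and non-trivial if $k\ge1$. $V$ is a gradient vector field if it has no non-trivial closed $V$-path. A primitive gradient vector field is a single pair $\{(v,e)\}$. The Morse complex $\mathcal{M}(G)$ is the simplicial complex whose vertices are the primitive gradient vector fields of $G$, a set of them forming a simplex iff their union is a gradient vector field. Homotopy equivalence refers to geometric realizations. $P_t$ is the path with vertices $v_0,\dots,v_t$ and edges $\{v_{i-1},v_i\}$, $1\le i\le t$. The extended star graph $S_{m,n}$ is the one-point union, at a common vertex (the center), of $m$ paths of length $1$ and $n$ paths of length $2$. $P_t\vee S_{m,n}\vee S_{k,l}$ denotes the graph obtained from $P_t$, $S_{m,n}$, $S_{k,l}$ by identifying the center of $S_{m,n}$ with $v_0$ and the center of $S_{k,l}$ with $v_t$.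 *)

theory Defs
  imports "HOL-Analysis.Analysis"
begin

text \<open>
  An abstract simplicial complex is represented by the set of its (nonempty) simplices,
  its vertices being the points of its simplices.  The predicate is not called
  \<open>simplicial_complex\<close> because that name denotes geometric complexes in the library.
\<close>

definition abstract_complex :: "'a set set \<Rightarrow> bool" where
  "abstract_complex K \<longleftrightarrow>
     (\<forall>\<sigma>\<in>K. finite \<sigma> \<and> \<sigma> \<noteq> {}) \<and>
     (\<forall>\<sigma>\<in>K. \<forall>\<tau>. \<tau> \<noteq> {} \<and> \<tau> \<subseteq> \<sigma> \<longrightarrow> \<tau> \<in> K)"

text \<open>
  Geometric realization: points are given by their barycentric coordinates, and the topology
  is the weak (coherent) one, in which a set is open iff it meets every closed simplex in an
  open subset of that simplex.  Function spaces carry the product topology, which on a closed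
  simplex, only finitely many coordinates being nonzero there, is the Euclidean one.
\<close>

definition closed_simplex :: "'a set \<Rightarrow> ('a \<Rightarrow> real) set" where
  "closed_simplex \<sigma> = {x. (\<forall>v. 0 \<le> x v) \<and> (\<forall>v. v \<notin> \<sigma> \<longrightarrow> x v = 0) \<and> (\<Sum>v\<in>\<sigma>. x v) = 1}"

definition geometric_realization :: "'a set set \<Rightarrow> ('a \<Rightarrow> real) topology" where
  "geometric_realization K =
     topology (\<lambda>U. U \<subseteq> (\<Union>\<sigma>\<in>K. closed_simplex \<sigma>) \<and>
                   (\<forall>\<sigma>\<in>K. openin (top_of_set (closed_simplex \<sigma>)) (U \<inter> closed_simplex \<sigma>)))"

lemma openin_geometric_realization:
  "openin (geometric_realization K) U \<longleftrightarrow>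
     U \<subseteq> (\<Union>\<sigma>\<in>K. closed_simplex \<sigma>) \<and>
     (\<forall>\<sigma>\<in>K. openin (top_of_set (closed_simplex \<sigma>)) (U \<inter> closed_simplex \<sigma>))"
proof -
  let ?P = "\<lambda>U. U \<subseteq> (\<Union>\<sigma>\<in>K. closed_simplex \<sigma>) \<and>
                (\<forall>\<sigma>\<in>K. openin (top_of_set (closed_simplex \<sigma>)) (U \<inter> closed_simplex \<sigma>))"
  have "istopology ?P"
    unfolding istopology_def
  proof (intro conjI allI impI)
    fix S T assume S: "?P S" and T: "?P T"
    show "S \<inter> T \<subseteq> (\<Union>\<sigma>\<in>K. closed_simplex \<sigma>)" using S by blast
    show "\<forall>\<sigma>\<in>K. openin (top_of_set (closed_simplex \<sigma>)) (S \<inter> T \<inter> closed_simplex \<sigma>)"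
    proof
      fix \<sigma> assume "\<sigma> \<in> K"
      with S T have "openin (top_of_set (closed_simplex \<sigma>))
                       ((S \<inter> closed_simplex \<sigma>) \<inter> (T \<inter> closed_simplex \<sigma>))"
        by (intro openin_Int[of _ "S \<inter> closed_simplex \<sigma>"]) blast+
      then show "openin (top_of_set (closed_simplex \<sigma>)) (S \<inter> T \<inter> closed_simplex \<sigma>)"
        by (simp add: Int_ac)
    qed
  next
    fix \<U> assume \<U>: "\<forall>S\<in>\<U>. ?P S"
    then show "\<Union>\<U> \<subseteq> (\<Union>\<sigma>\<in>K. closed_simplex \<sigma>)" by blast
    show "\<forall>\<sigma>\<in>K. openin (top_of_set (closed_simplex \<sigma>)) (\<Union>\<U> \<inter> closed_simplex \<sigma>)"
    proof
      fix \<sigma> assume "\<sigma> \<in> K"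
      with \<U> have "openin (top_of_set (closed_simplex \<sigma>)) (\<Union>S\<in>\<U>. S \<inter> closed_simplex \<sigma>)"
        by (intro openin_Union) auto
      then show "openin (top_of_set (closed_simplex \<sigma>)) (\<Union>\<U> \<inter> closed_simplex \<sigma>)"
        by (simp only: Int_Union2)
    qed
  qed
  then show ?thesis
    unfolding geometric_realization_def by (simp add: topology_inverse')
qed

lemma closed_closed_simplex: "closed (closed_simplex \<sigma>)"
proof -
  have "closed_simplex \<sigma> =
          (\<Inter>v. {x. 0 \<le> x v}) \<inter> (\<Inter>v\<in>-\<sigma>. {x. x v = 0}) \<inter> {x. (\<Sum>v\<in>\<sigma>. x v) = 1}"
    by (auto simp: closed_simplex_def)
  moreover have "closed \<dots>"
    by (intro closed_Int closed_INT ballI closed_Collect_le closed_Collect_eq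
          continuous_intros continuous_on_product_coordinates)
  ultimately show ?thesis by simp
qed

lemma geometric_realization_finite:
  assumes "finite K"
  shows "geometric_realization K = top_of_set (\<Union>\<sigma>\<in>K. closed_simplex \<sigma>)"
proof (rule topology_eq[THEN iffD2], intro allI iffI)
  let ?R = "\<Union>\<sigma>\<in>K. closed_simplex \<sigma>"
  fix U
  {
    assume U: "openin (geometric_realization K) U"
    have "closed (closed_simplex \<sigma> - U)" if "\<sigma> \<in> K" for \<sigma>
    proof -
      have "closedin (top_of_set (closed_simplex \<sigma>)) (closed_simplex \<sigma> - U \<inter> closed_simplex \<sigma>)"
        using U that by (intro closedin_diff) (auto simp: openin_geometric_realization)
      then have "closed (closed_simplex \<sigma> - U \<inter> closed_simplex \<sigma>)"
        using closed_closed_simplex closedin_closed_trans by blast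
      then show ?thesis by (simp add: Diff_Int_distrib2 Diff_Int)
    qed
    then have "closed (\<Union>\<sigma>\<in>K. closed_simplex \<sigma> - U)"
      using assms by (intro closed_UN) auto
    moreover have "U = ?R \<inter> - (\<Union>\<sigma>\<in>K. closed_simplex \<sigma> - U)"
      using U by (auto simp: openin_geometric_realization)
    ultimately show "openin (top_of_set ?R) U"
      by (metis openin_open open_Compl)
  }
  {
    assume "openin (top_of_set ?R) U"
    then obtain T where T: "open T" "U = ?R \<inter> T"
      by (auto simp: openin_open)
    have "openin (top_of_set (closed_simplex \<sigma>)) (U \<inter> closed_simplex \<sigma>)" if "\<sigma> \<in> K" for \<sigma>
    proof -
      have "U \<inter> closed_simplex \<sigma> = closed_simplex \<sigma> \<inter> T" using T that by auto
      then show ?thesis using T(1) by (auto simp: openin_open)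
    qed
    then show "openin (geometric_realization K) U"
      using T by (auto simp: openin_geometric_realization)
  }
qed


text \<open>
  In the following definitions a graph \<open>G\<close> is an abstract complex of dimension at most one.
\<close>

definition edges :: "'a set set \<Rightarrow> 'a set set" where
  "edges G = {e \<in> G. card e = 2}"

definition discrete_vector_field :: "'a set set \<Rightarrow> ('a \<times> 'a set) set \<Rightarrow> bool" where
  "discrete_vector_field G V \<longleftrightarrow>
     (\<forall>(v, e)\<in>V. {v} \<in> G \<and> e \<in> edges G \<and> v \<in> e) \<and> inj_on fst V \<and> inj_on snd V"

text \<open>
  A path is given by its list \<open>vs\<close> of vertices and its list \<open>es\<close> of edges, so that \<open>length es\<close>
  is the number of its steps.
\<close>

definition V_path :: "('a \<times> 'a set) set \<Rightarrow> 'a list \<Rightarrow> 'a set list \<Rightarrow> bool" where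
  "V_path V vs es \<longleftrightarrow>
     length vs = Suc (length es) \<and>
     (\<forall>i<length es. (vs ! i, es ! i) \<in> V \<and> vs ! Suc i \<in> es ! i \<and> vs ! Suc i \<noteq> vs ! i)"

definition gradient_vector_field :: "'a set set \<Rightarrow> ('a \<times> 'a set) set \<Rightarrow> bool" where
  "gradient_vector_field G V \<longleftrightarrow>
     discrete_vector_field G V \<and>
     \<not> (\<exists>vs es. V_path V vs es \<and> 1 \<le> length es \<and> last vs = hd vs)"

definition primitive_gradient_vector_field :: "'a set set \<Rightarrow> ('a \<times> 'a set) set \<Rightarrow> bool" where
  "primitive_gradient_vector_field G V \<longleftrightarrow>
     gradient_vector_field G V \<and> (\<exists>v e. V = {(v, e)})"

definition morse_complex :: "'a set set \<Rightarrow> ('a \<times> 'a set) set set set" where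
  "morse_complex G =
     {S. finite S \<and> S \<noteq> {} \<and> (\<forall>V\<in>S. primitive_gradient_vector_field G V) \<and>
         gradient_vector_field G (\<Union>S)}"

lemma gradient_vector_field_subset:
  assumes "gradient_vector_field G V" "W \<subseteq> V"
  shows "gradient_vector_field G W"
proof -
  have "V_path V vs es" if "V_path W vs es" for vs es
    using that assms(2) by (auto simp: V_path_def)
  moreover have "discrete_vector_field G W"
    using assms by (auto simp: gradient_vector_field_def discrete_vector_field_def
        intro: inj_on_subset)
  ultimately show ?thesis
    using assms(1) unfolding gradient_vector_field_def by blast
qed

lemma abstract_complex_morse_complex: "abstract_complex (morse_complex G)"
  unfolding abstract_complex_def
proof (intro conjI ballI allI impI)
  fix S assume S: "S \<in> morse_complex G"
  then show "finite S" "S \<noteq> {}" by (simp_all add: morse_complex_def)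
  fix T assume T: "T \<noteq> {} \<and> T \<subseteq> S"
  have "gradient_vector_field G (\<Union>T)"
  proof (rule gradient_vector_field_subset)
    show "gradient_vector_field G (\<Union>S)" using S by (simp add: morse_complex_def)
    show "\<Union>T \<subseteq> \<Union>S" using T by blast
  qed
  moreover have "finite T"
    using S T by (auto simp: morse_complex_def dest: finite_subset)
  ultimately show "T \<in> morse_complex G"
    using S T by (auto simp: morse_complex_def)
qed


definition path_graph :: "nat \<Rightarrow> nat set set" where
  "path_graph t = {{i} | i. i \<le> t} \<union> {{i - 1, i} | i. 1 \<le> i \<and> i \<le> t}"

text \<open>
  The extended star: \<open>Leaf i\<close> is the end of the \<open>i\<close>-th path of length 1, while \<open>Mid j\<close> and
  \<open>Tip j\<close> are the middle vertex and the end of the \<open>j\<close>-th path of length 2.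
\<close>

datatype star_vertex = Center | Leaf nat | Mid nat | Tip nat

definition extended_star :: "nat \<Rightarrow> nat \<Rightarrow> star_vertex set set" where
  "extended_star m n =
     {{Center}} \<union>
     (\<Union>i<m. {{Leaf i}, {Center, Leaf i}}) \<union>
     (\<Union>j<n. {{Mid j}, {Tip j}, {Center, Mid j}, {Mid j, Tip j}})"

text \<open>
  \<open>path_wedge_stars t m n k l\<close> is the image of the disjoint union of \<open>P\<^sub>t\<close>, \<open>S\<^bsub>m,n\<^esub>\<close> and \<open>S\<^bsub>k,l\<^esub>\<close>
  under the map \<open>attach_centers t\<close>, which identifies the first center with the vertex \<open>0\<close> and
  the second one with the vertex \<open>t\<close> of the path, and is injective otherwise.
\<close>

type_synonym wedge_vertex = "nat + (star_vertex + star_vertex)"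

definition attach_centers :: "nat \<Rightarrow> wedge_vertex \<Rightarrow> wedge_vertex" where
  "attach_centers t x =
     (if x = Inr (Inl Center) then Inl 0
      else if x = Inr (Inr Center) then Inl t
      else x)"

definition disjoint_union3 ::
  "'a set set \<Rightarrow> 'b set set \<Rightarrow> 'c set set \<Rightarrow> ('a + ('b + 'c)) set set" where
  "disjoint_union3 G H K =
     image Inl ` G \<union> image (Inr \<circ> Inl) ` H \<union> image (Inr \<circ> Inr) ` K"

definition path_wedge_stars :: "nat \<Rightarrow> nat \<Rightarrow> nat \<Rightarrow> nat \<Rightarrow> nat \<Rightarrow> wedge_vertex set set" where
  "path_wedge_stars t m n k l =
     image (attach_centers t) `
       disjoint_union3 (path_graph t) (extended_star m n) (extended_star k l)"

lemma abstract_complex_graphI: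
  assumes "\<And>\<sigma>. \<sigma> \<in> G \<Longrightarrow> \<exists>a b. \<sigma> = {a, b} \<and> {a} \<in> G \<and> {b} \<in> G"
  shows "abstract_complex G"
  unfolding abstract_complex_def
proof (intro conjI ballI allI impI)
  fix \<sigma> assume \<sigma>: "\<sigma> \<in> G"
  then obtain a b where ab: "\<sigma> = {a, b}" "{a} \<in> G" "{b} \<in> G"
    using assms by blast
  show "finite \<sigma>" "\<sigma> \<noteq> {}" using ab by auto
  fix \<tau> assume "\<tau> \<noteq> {} \<and> \<tau> \<subseteq> \<sigma>"
  then have "\<tau> = {a} \<or> \<tau> = {b} \<or> \<tau> = {a, b}"
    using ab(1) by blast
  then show "\<tau> \<in> G" using ab \<sigma> by metis
qed

lemma abstract_complex_path_graph: "abstract_complex (path_graph t)"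
proof (rule abstract_complex_graphI)
  fix \<sigma> assume "\<sigma> \<in> path_graph t"
  then consider i where "\<sigma> = {i}" "i \<le> t" | i where "\<sigma> = {i - 1, i}" "1 \<le> i" "i \<le> t"
    by (auto simp: path_graph_def)
  then show "\<exists>a b. \<sigma> = {a, b} \<and> {a} \<in> path_graph t \<and> {b} \<in> path_graph t"
  proof cases
    case 1
    then show ?thesis by (intro exI[of _ i]) (simp add: path_graph_def)
  next
    case 2
    then have "{i - 1} \<in> path_graph t" "{i} \<in> path_graph t"
      by (auto simp: path_graph_def)
    then show ?thesis using 2(1) by blast
  qed
qed

lemma abstract_complex_extended_star: "abstract_complex (extended_star m n)"
proof (rule abstract_complex_graphI)
  let ?S = "extended_star m n"
  fix \<sigma> assume "\<sigma> \<in> ?S"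
  then consider x where "\<sigma> = {x}" "{x} \<in> ?S"
    | i where "\<sigma> = {Center, Leaf i}" "i < m"
    | j where "\<sigma> = {Center, Mid j}" "j < n"
    | j where "\<sigma> = {Mid j, Tip j}" "j < n"
    by (auto simp: extended_star_def)
  then show "\<exists>a b. \<sigma> = {a, b} \<and> {a} \<in> ?S \<and> {b} \<in> ?S"
  proof cases
    case 1
    then show ?thesis by (intro exI[of _ x]) simp
  next
    case 2
    then show ?thesis
      by (intro exI[of _ Center] exI[of _ "Leaf i"]) (auto simp: extended_star_def)
  next
    case 3
    then show ?thesis
      by (intro exI[of _ Center] exI[of _ "Mid j"]) (auto simp: extended_star_def)
  next
    case 4
    then show ?thesis
      by (intro exI[of _ "Mid j"] exI[of _ "Tip j"]) (auto simp: extended_star_def)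
  qed
qed

lemma abstract_complex_image:
  assumes "abstract_complex K"
  shows "abstract_complex (image f ` K)"
  unfolding abstract_complex_def
proof (intro conjI ballI allI impI)
  fix \<sigma> assume "\<sigma> \<in> image f ` K"
  then obtain \<rho> where \<rho>: "\<rho> \<in> K" "\<sigma> = f ` \<rho>" by blast
  show "finite \<sigma>" "\<sigma> \<noteq> {}" using \<rho> assms by (auto simp: abstract_complex_def)
  fix \<tau> assume \<tau>: "\<tau> \<noteq> {} \<and> \<tau> \<subseteq> \<sigma>"
  then obtain \<pi> where \<pi>: "\<pi> \<subseteq> \<rho>" "\<tau> = f ` \<pi>"
    using \<rho>(2) by (auto simp: subset_image_iff)
  then have "\<pi> \<in> K" using \<tau> \<rho>(1) assms unfolding abstract_complex_def by blast
  then show "\<tau> \<in> image f ` K" using \<pi>(2) by blast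
qed

lemma abstract_complex_Un:
  assumes "abstract_complex K" "abstract_complex L"
  shows "abstract_complex (K \<union> L)"
  unfolding abstract_complex_def
proof (intro conjI ballI allI impI)
  fix \<sigma> assume \<sigma>: "\<sigma> \<in> K \<union> L"
  then show "finite \<sigma>" "\<sigma> \<noteq> {}" using assms by (auto simp: abstract_complex_def)
  fix \<tau> assume "\<tau> \<noteq> {} \<and> \<tau> \<subseteq> \<sigma>"
  then show "\<tau> \<in> K \<union> L" using \<sigma> assms unfolding abstract_complex_def by (meson Un_iff)
qed

lemma abstract_complex_path_wedge_stars: "abstract_complex (path_wedge_stars t m n k l)"
proof -
  have "abstract_complex (disjoint_union3 (path_graph t) (extended_star m n) (extended_star k l))"
    unfolding disjoint_union3_def
    by (intro abstract_complex_Un abstract_complex_image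
        abstract_complex_path_graph abstract_complex_extended_star)
  then show ?thesis
    unfolding path_wedge_stars_def by (rule abstract_complex_image)
qed

lemma card_path_wedge_stars_le:
  assumes "\<sigma> \<in> path_wedge_stars t m n k l"
  shows "card \<sigma> \<le> 2"
proof -
  have [simp]: "card {a, b} \<le> 2" for a b :: 'z
    by (simp add: card_insert_if)
  show ?thesis
    using assms unfolding path_wedge_stars_def disjoint_union3_def path_graph_def extended_star_def
    by auto
qed

end

theory Submission
  imports Defs
begin

text \<open>
  The graph is a tree, so a discrete vector field on it is automatically a gradient field, and the
  Morse complex is the independence complex of the conflict graph of the arcs \<open>(v, w)\<close>, which stand
  for the pairs \<open>(v, {v, w})\<close>: two arcs are in conflict when they have the same source or are
  opposite.  In an independence complex a vertex \<open>v\<close> may be deleted without changing the homotopy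
  type if some other vertex \<open>u\<close> satisfies \<open>N(u) \<subseteq> N(v)\<close>.  If \<open>x\<close> is a leaf at \<open>c\<close>, then \<open>(x, c)\<close> is
  in conflict with \<open>(c, x)\<close> only, and so it dominates all other arcs with source \<open>c\<close>.  For the
  leaves at the two centers and the tips of the long arms, this leaves \<open>n + l + 2\<close> pairs of opposite
  arcs, which are disjoint edges of the conflict graph, and a path on \<open>2t - 2\<close> vertices, which folds
  to disjoint edges, followed by an isolated vertex when \<open>3\<close> divides \<open>t\<close>.  An isolated vertex makes
  the complex a cone, while \<open>k + 1\<close> disjoint edges give the boundary of a cross-polytope, a
  \<open>k\<close>-sphere.  For \<open>t = 0\<close> the two leaves are attached to the same center, and each of them isolates
  the other.
\<close>

section \<open>Maps between geometric realizations\<close>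

lemma topspace_geometric_realization:
  "topspace (geometric_realization K) = (\<Union>\<sigma>\<in>K. closed_simplex \<sigma>)"
proof (rule antisym)
  show "topspace (geometric_realization K) \<subseteq> (\<Union>\<sigma>\<in>K. closed_simplex \<sigma>)"
    using openin_topspace[of "geometric_realization K"]
    unfolding openin_geometric_realization by blast
  have "openin (geometric_realization K) (\<Union>\<sigma>\<in>K. closed_simplex \<sigma>)"
    unfolding openin_geometric_realization
    by (metis Int_absorb1 UN_upper openin_subtopology_self order_refl)
  then show "(\<Union>\<sigma>\<in>K. closed_simplex \<sigma>) \<subseteq> topspace (geometric_realization K)"
    by (rule openin_subset)
qed

lemma continuous_map_geometric_realization:
  assumes cont: "\<And>\<sigma>. \<sigma> \<in> K \<Longrightarrow> continuous_on (closed_simplex \<sigma>) f"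
    and simplex: "\<And>\<sigma>. \<sigma> \<in> K \<Longrightarrow> \<exists>\<tau>\<in>L. f ` closed_simplex \<sigma> \<subseteq> closed_simplex \<tau>"
  shows "continuous_map (geometric_realization K) (geometric_realization L) f"
  unfolding continuous_map_def
proof (intro conjI allI impI)
  show "f \<in> topspace (geometric_realization K) \<rightarrow> topspace (geometric_realization L)"
    using simplex unfolding topspace_geometric_realization by blast
  fix U assume U: "openin (geometric_realization L) U"
  let ?V = "{x \<in> topspace (geometric_realization K). f x \<in> U}"
  have "openin (top_of_set (closed_simplex \<sigma>)) (?V \<inter> closed_simplex \<sigma>)" if "\<sigma> \<in> K" for \<sigma>
  proof -
    obtain \<tau> where \<tau>: "\<tau> \<in> L" "f ` closed_simplex \<sigma> \<subseteq> closed_simplex \<tau>"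
      using simplex[OF \<open>\<sigma> \<in> K\<close>] by blast
    have "openin (top_of_set (closed_simplex \<sigma>))
            (closed_simplex \<sigma> \<inter> f -` (U \<inter> closed_simplex \<tau>))"
    proof (rule continuous_openin_preimage[OF cont[OF that]])
      show "f \<in> closed_simplex \<sigma> \<rightarrow> closed_simplex \<tau>" using \<tau> by blast
      show "openin (top_of_set (closed_simplex \<tau>)) (U \<inter> closed_simplex \<tau>)"
        using U \<tau> by (simp add: openin_geometric_realization)
    qed
    also have "closed_simplex \<sigma> \<inter> f -` (U \<inter> closed_simplex \<tau>) = ?V \<inter> closed_simplex \<sigma>"
      using \<tau> that by (auto simp: topspace_geometric_realization)
    finally show ?thesis .
  qed
  then show "openin (geometric_realization K) ?V"
    unfolding openin_geometric_realization by (auto simp: topspace_geometric_realization)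
qed

lemma continuous_on_product_coordinate [continuous_intros]: "continuous_on S (\<lambda>x. x i)"
  by (rule continuous_on_subset[OF continuous_on_product_coordinates]) simp

definition pullback :: "'b set \<Rightarrow> ('b \<Rightarrow> 'a) \<Rightarrow> ('a \<Rightarrow> real) \<Rightarrow> 'b \<Rightarrow> real" where
  "pullback B g x = (\<lambda>w. if w \<in> B then x (g w) else 0)"

lemma continuous_on_pullback: "continuous_on S (pullback B g)"
proof (rule continuous_on_coordinatewise_then_product)
  show "continuous_on S (\<lambda>x. pullback B g x w)" for w
    by (cases "w \<in> B") (simp_all add: pullback_def continuous_on_product_coordinate)
qed

lemma pullback_in_closed_simplex:
  assumes inj: "inj_on g B" and \<tau>: "\<tau> \<subseteq> B" and x: "x \<in> closed_simplex (g ` \<tau>)"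
  shows "pullback B g x \<in> closed_simplex \<tau>"
  unfolding closed_simplex_def
proof (intro CollectI conjI allI impI)
  show "0 \<le> pullback B g x w" for w
    using x by (simp add: pullback_def closed_simplex_def)
  show "pullback B g x w = 0" if "w \<notin> \<tau>" for w
  proof (cases "w \<in> B")
    case True
    then have "g w \<notin> g ` \<tau>" using that inj \<tau> by (auto dest: inj_onD)
    then show ?thesis using x by (simp add: pullback_def closed_simplex_def)
  qed (simp add: pullback_def)
  have "(\<Sum>w\<in>\<tau>. pullback B g x w) = (\<Sum>w\<in>\<tau>. x (g w))"
    using \<tau> by (intro sum.cong) (auto simp: pullback_def)
  also have "\<dots> = (\<Sum>v\<in>g ` \<tau>. x v)"
    using inj_on_subset[OF inj \<tau>] by (simp add: sum.reindex)
  also have "\<dots> = 1" using x by (simp add: closed_simplex_def)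
  finally show "(\<Sum>w\<in>\<tau>. pullback B g x w) = 1" .
qed

lemma pullback_pullback:
  assumes "\<And>w. w \<in> B \<Longrightarrow> g w \<in> A \<and> h (g w) = w" and "\<And>w. w \<notin> B \<Longrightarrow> y w = 0"
  shows "pullback B g (pullback A h y) = y"
proof
  show "pullback B g (pullback A h y) w = y w" for w
    using assms by (cases "w \<in> B") (simp_all add: pullback_def)
qed

lemma geometric_realization_image:
  assumes inj: "inj_on f (\<Union>K)"
  shows "geometric_realization (image f ` K) homeomorphic_space geometric_realization K"
proof -
  let ?g = "inv_into (\<Union>K) f"
  let ?down = "pullback (\<Union>K) f" and ?up = "pullback (f ` \<Union>K) ?g"
  have down: "?down y \<in> closed_simplex \<sigma>" if "\<sigma> \<in> K" "y \<in> closed_simplex (f ` \<sigma>)" for \<sigma> y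
    using that by (intro pullback_in_closed_simplex[OF inj]) auto
  have up: "?up x \<in> closed_simplex (f ` \<sigma>)" if "\<sigma> \<in> K" "x \<in> closed_simplex \<sigma>" for \<sigma> x
  proof (rule pullback_in_closed_simplex)
    show "inj_on ?g (f ` \<Union>K)" by (rule inj_on_inv_into) simp
    have "?g ` f ` \<sigma> = \<sigma>" using that inj by (intro inv_into_image_cancel) auto
    then show "x \<in> closed_simplex (?g ` f ` \<sigma>)" using that by simp
  qed (use that in blast)
  have "continuous_map (geometric_realization (image f ` K)) (geometric_realization K) ?down"
    using down by (intro continuous_map_geometric_realization continuous_on_pullback) blast
  moreover have "continuous_map (geometric_realization K) (geometric_realization (image f ` K)) ?up"
    using up by (intro continuous_map_geometric_realization continuous_on_pullback) blast
  moreover have "?up (?down y) = y" if "\<sigma> \<in> K" "y \<in> closed_simplex (f ` \<sigma>)" for \<sigma> y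
  proof (rule pullback_pullback)
    show "y p = 0" if "p \<notin> f ` \<Union>K" for p
    proof -
      have "p \<notin> f ` \<sigma>" using that \<open>\<sigma> \<in> K\<close> by blast
      then show ?thesis using \<open>y \<in> _\<close> by (simp add: closed_simplex_def)
    qed
  qed (simp add: inv_into_into f_inv_into_f del: Union_iff)
  moreover have "?down (?up x) = x" if "\<sigma> \<in> K" "x \<in> closed_simplex \<sigma>" for \<sigma> x
    by (rule pullback_pullback) (use that inj in \<open>auto simp: closed_simplex_def\<close>)
  ultimately have
    "homeomorphic_maps (geometric_realization (image f ` K)) (geometric_realization K) ?down ?up"
    by (auto simp: homeomorphic_maps_def topspace_geometric_realization)
  then show ?thesis by (auto simp: homeomorphic_space_def)
qed

section \<open>Deletion of dominated vertices\<close>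

definition support :: "('a \<Rightarrow> real) \<Rightarrow> 'a set" where
  "support x = {v. x v \<noteq> 0}"

lemma closed_simplex_Diff:
  assumes "finite \<sigma>"
  shows "x \<in> closed_simplex (\<sigma> - \<tau>) \<longleftrightarrow> x \<in> closed_simplex \<sigma> \<and> support x \<inter> \<tau> = {}"
proof -
  have "sum x (\<sigma> - \<tau>) = sum x \<sigma>" if "\<forall>v\<in>\<sigma> \<inter> \<tau>. x v = 0"
    using that assms by (intro sum.mono_neutral_left) auto
  moreover have "(\<forall>v. v \<notin> \<sigma> - \<tau> \<longrightarrow> x v = 0) \<longleftrightarrow>
      (\<forall>v. v \<notin> \<sigma> \<longrightarrow> x v = 0) \<and> (\<forall>v\<in>\<sigma> \<inter> \<tau>. x v = 0)"
    by blast
  moreover have "support x \<inter> \<tau> = {} \<longleftrightarrow> (\<forall>v\<in>\<sigma> \<inter> \<tau>. x v = 0)" if "\<forall>v. v \<notin> \<sigma> \<longrightarrow> x v = 0"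
    using that by (auto simp: support_def)
  ultimately show ?thesis unfolding closed_simplex_def by auto
qed

lemma closed_simplex_mono:
  assumes "\<sigma> \<subseteq> \<tau>" "finite \<tau>"
  shows "closed_simplex \<sigma> \<subseteq> closed_simplex \<tau>"
  using closed_simplex_Diff[OF assms(2), of _ "\<tau> - \<sigma>"] assms(1) by (auto simp: double_diff)

lemma support_subset:
  assumes "x \<in> closed_simplex \<sigma>"
  shows "support x \<subseteq> \<sigma>" "support x \<noteq> {}"
  using assms by (auto simp: closed_simplex_def support_def intro: ccontr)

lemma in_Union_closed_simplex_iff:
  assumes K: "abstract_complex K"
  shows "x \<in> (\<Union>\<sigma>\<in>K. closed_simplex \<sigma>) \<longleftrightarrow> support x \<in> K \<and> x \<in> closed_simplex (support x)"
proof
  assume "x \<in> (\<Union>\<sigma>\<in>K. closed_simplex \<sigma>)"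
  then obtain \<sigma> where \<sigma>: "\<sigma> \<in> K" "x \<in> closed_simplex \<sigma>" by blast
  then have "finite \<sigma>" "support x \<in> K"
    using K support_subset[OF \<sigma>(2)] unfolding abstract_complex_def by blast+
  moreover have "\<sigma> - (\<sigma> - support x) = support x"
    using support_subset[OF \<sigma>(2)] by blast
  ultimately show "support x \<in> K \<and> x \<in> closed_simplex (support x)"
    using closed_simplex_Diff[of \<sigma> x "\<sigma> - support x"] \<sigma>(2) by auto
qed blast

definition deletion :: "'a set set \<Rightarrow> 'a set \<Rightarrow> 'a set set" where
  "deletion K D = {\<sigma> \<in> K. \<sigma> \<inter> D = {}}"

lemma abstract_complex_deletion: "abstract_complex K \<Longrightarrow> abstract_complex (deletion K D)"
  unfolding abstract_complex_def deletion_def by blast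

lemma deletion_deletion: "deletion (deletion K A) B = deletion K (A \<union> B)"
  by (auto simp: deletion_def)

lemma transfer_in_closed_simplex:
  assumes x: "x \<in> closed_simplex \<sigma>" and "finite \<sigma>" and "u \<noteq> v" and r: "0 \<le> r" "r \<le> x v"
  shows "x(u := x u + r, v := x v - r) \<in> closed_simplex (insert u (insert v \<sigma>))"
proof -
  define \<tau> where "\<tau> = insert u (insert v \<sigma>)"
  have \<tau>: "finite \<tau>" "u \<in> \<tau>" "v \<in> \<tau> - {u}" using assms by (auto simp: \<tau>_def)
  have x': "x \<in> closed_simplex \<tau>"
    using x closed_simplex_mono[OF _ \<tau>(1), of \<sigma>] by (auto simp: \<tau>_def)
  have sum_split: "sum y \<tau> = y u + (y v + sum y (\<tau> - {u} - {v}))" for y :: "'a \<Rightarrow> real"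
    using \<tau> sum.remove[of \<tau> u y] sum.remove[of "\<tau> - {u}" v y] by simp
  have "sum (x(u := x u + r, v := x v - r)) (\<tau> - {u} - {v}) = sum x (\<tau> - {u} - {v})"
    by (rule sum.cong) auto
  then have "sum (x(u := x u + r, v := x v - r)) \<tau> = sum x \<tau>"
    unfolding sum_split using \<open>u \<noteq> v\<close> by simp
  then show ?thesis
    using x' r \<tau> unfolding \<tau>_def[symmetric] by (auto simp: closed_simplex_def)
qed

definition shift_weight :: "'a \<Rightarrow> 'a \<Rightarrow> real \<times> ('a \<Rightarrow> real) \<Rightarrow> 'a \<Rightarrow> real" where
  "shift_weight u v = (\<lambda>(s, x). x(u := x u + (1 - s) * x v, v := x v - (1 - s) * x v))"

lemma continuous_on_shift_weight: "continuous_on S (shift_weight u v)"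
proof (rule continuous_on_coordinatewise_then_product)
  fix i
  have coordinate: "continuous_on S (\<lambda>z. snd z j)" for j
    by (rule continuous_on_product_then_coordinatewise) (intro continuous_intros)
  show "continuous_on S (\<lambda>z. shift_weight u v z i)"
    unfolding shift_weight_def case_prod_beta
    by (cases "i = v"; cases "i = u") (auto intro!: continuous_intros coordinate)
qed

lemma Union_closed_simplex_deletion:
  assumes "abstract_complex K"
  shows "(\<Union>\<sigma>\<in>deletion K D. closed_simplex \<sigma>) =
           {x \<in> \<Union>\<sigma>\<in>K. closed_simplex \<sigma>. support x \<inter> D = {}}"
  unfolding set_eq_iff mem_Collect_eq in_Union_closed_simplex_iff[OF assms]
    in_Union_closed_simplex_iff[OF abstract_complex_deletion[OF assms]]
  by (auto simp: deletion_def)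

lemma shift_weight_in_Union_closed_simplex:
  assumes K: "abstract_complex K" and "u \<noteq> v"
    and dominated: "\<And>\<sigma>. \<sigma> \<in> K \<Longrightarrow> v \<in> \<sigma> \<Longrightarrow> insert u \<sigma> \<in> K"
    and x: "x \<in> (\<Union>\<sigma>\<in>K. closed_simplex \<sigma>)" and s: "s \<in> {0..1}"
  shows "shift_weight u v (s, x) \<in> (\<Union>\<sigma>\<in>K. closed_simplex \<sigma>)"
proof (cases "x v = 0")
  case True
  then have "shift_weight u v (s, x) = x" by (auto simp: shift_weight_def)
  then show ?thesis using x by simp
next
  case False
  obtain \<sigma> where \<sigma>: "\<sigma> \<in> K" "x \<in> closed_simplex \<sigma>" using x by blast
  then have "v \<in> \<sigma>" "0 \<le> x v" using False by (auto simp: closed_simplex_def)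
  moreover have "finite \<sigma>" using K \<sigma>(1) unfolding abstract_complex_def by blast
  ultimately have "shift_weight u v (s, x) \<in> closed_simplex (insert u \<sigma>)"
    using s transfer_in_closed_simplex[OF \<sigma>(2) _ \<open>u \<noteq> v\<close>, of "(1 - s) * x v"]
    by (simp add: shift_weight_def insert_absorb mult_left_le_one_le)
  then show ?thesis using dominated[OF \<sigma>(1) \<open>v \<in> \<sigma>\<close>] by blast
qed

lemma geometric_realization_delete_dominated:
  assumes K: "abstract_complex K" "finite K" and "u \<noteq> v"
    and dominated: "\<And>\<sigma>. \<sigma> \<in> K \<Longrightarrow> v \<in> \<sigma> \<Longrightarrow> insert u \<sigma> \<in> K"
  shows "geometric_realization K homotopy_equivalent_space geometric_realization (deletion K {v})"
proof -
  define P where "P = (\<Union>\<sigma>\<in>K. closed_simplex \<sigma>)"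
  define Q where "Q = (\<Union>\<sigma>\<in>deletion K {v}. closed_simplex \<sigma>)"
  let ?h = "shift_weight u v"
  have Q_eq: "Q = {x \<in> P. x v = 0}"
    unfolding P_def Q_def Union_closed_simplex_deletion[OF K(1)] by (simp add: support_def)
  have h_P: "?h (s, x) \<in> P" if "x \<in> P" "s \<in> {0..1}" for s x
    using that shift_weight_in_Union_closed_simplex[OF K(1) \<open>u \<noteq> v\<close> dominated]
    unfolding P_def by blast
  have "top_of_set P homotopy_equivalent_space top_of_set Q"
  proof (rule deformation_retract_imp_homotopy_equivalent_space)
    show "homotopic_with (\<lambda>x. True) (top_of_set P) (top_of_set P) (\<lambda>x. ?h (0, x)) id"
      unfolding homotopic_with_def
    proof (intro exI conjI allI ballI)
      show "continuous_map (prod_topology (top_of_set {0..1}) (top_of_set P)) (top_of_set P) ?h"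
        using continuous_on_shift_weight h_P by auto
      show "?h (1, x) = id x" for x by (auto simp: shift_weight_def)
    qed auto
    have "continuous_on P (\<lambda>x. ?h (0, x))"
      by (rule continuous_on_compose2[OF continuous_on_shift_weight[of UNIV]])
         (auto intro!: continuous_intros)
    moreover have "?h (0, x) \<in> Q" if "x \<in> P" for x
      using h_P[OF that, of 0] unfolding Q_eq by (simp add: shift_weight_def)
    moreover have "?h (0, x) = x" if "x \<in> Q" for x
      using that by (auto simp: Q_eq shift_weight_def)
    ultimately show "retraction_maps (top_of_set P) (top_of_set Q) (\<lambda>x. ?h (0, x)) id"
      unfolding retraction_maps_def by (auto simp: Q_eq)
  qed
  moreover have "finite (deletion K {v})" using K(2) by (simp add: deletion_def)
  ultimately show ?thesis using K(2) by (simp add: geometric_realization_finite P_def Q_def)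
qed

text \<open>The vertices of \<open>D\<close> are deleted in order of increasing rank.\<close>

lemma geometric_realization_delete_dominated_ranked:
  fixes rank :: "'a \<Rightarrow> 'b::linorder"
  assumes K: "abstract_complex K" "finite K" and "finite D"
    and "\<And>v. v \<in> D \<Longrightarrow> u v \<notin> D"
    and "\<And>v \<sigma>. \<sigma> \<in> K \<Longrightarrow> v \<in> \<sigma> \<inter> D \<Longrightarrow> \<forall>w\<in>\<sigma> \<inter> D. rank v \<le> rank w \<Longrightarrow> insert (u v) \<sigma> \<in> K"
  shows "geometric_realization K homotopy_equivalent_space geometric_realization (deletion K D)"
  using assms(3-)
proof (induction rule: finite_ranking_induct[where f = rank])
  case empty
  have "deletion K {} = K" by (simp add: deletion_def)
  then show ?case by (simp add: homotopy_equivalent_space_refl)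
next
  case (insert v D)
  have "geometric_realization K homotopy_equivalent_space geometric_realization (deletion K D)"
  proof (rule insert.IH)
    show "u v' \<notin> D" if "v' \<in> D" for v' using insert.prems(1)[of v'] that by blast
    show "insert (u v') \<sigma> \<in> K"
      if "\<sigma> \<in> K" "v' \<in> \<sigma> \<inter> D" "\<forall>w\<in>\<sigma> \<inter> D. rank v' \<le> rank w" for v' \<sigma>
      using that insert.hyps(2)[of v'] by (intro insert.prems(2)) auto
  qed
  also have "geometric_realization (deletion K D) homotopy_equivalent_space
      geometric_realization (deletion (deletion K D) {v})"
  proof (rule geometric_realization_delete_dominated[where u = "u v"])
    show "abstract_complex (deletion K D)" by (rule abstract_complex_deletion[OF K(1)])
    show "finite (deletion K D)" using K(2) by (simp add: deletion_def)
    have u: "u v \<notin> insert v D" by (rule insert.prems(1)) simp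
    then show "u v \<noteq> v" by blast
    show "insert (u v) \<sigma> \<in> deletion K D" if "\<sigma> \<in> deletion K D" "v \<in> \<sigma>" for \<sigma>
    proof -
      have "\<sigma> \<in> K" "\<sigma> \<inter> D = {}" using that by (auto simp: deletion_def)
      then have "insert (u v) \<sigma> \<in> K" using that(2) by (intro insert.prems(2)) auto
      then show ?thesis using u \<open>\<sigma> \<inter> D = {}\<close> by (simp add: deletion_def)
    qed
  qed
  also have "deletion (deletion K D) {v} = deletion K (insert v D)"
    by (simp add: deletion_deletion)
  finally show ?case .
qed

lemma singleton_homotopy_equivalent_point:
  "top_of_set {a :: 'a::topological_space} homotopy_equivalent_space discrete_topology {()}"
proof (rule homeomorphic_imp_homotopy_equivalent_space)
  have "homeomorphic_maps (top_of_set {a}) (discrete_topology {()}) (\<lambda>_. ()) (\<lambda>_. a)"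
    by (simp add: homeomorphic_maps_def)
  then show "top_of_set {a} homeomorphic_space discrete_topology {()}"
    unfolding homeomorphic_space_def by (intro exI)
qed

lemma geometric_realization_singleton:
  "geometric_realization {{u}} = top_of_set {\<lambda>v. if v = u then 1 else 0}"
proof -
  have "closed_simplex {u} = {\<lambda>v. if v = u then 1 else 0}"
    by (auto simp: closed_simplex_def fun_eq_iff)
  then show ?thesis
    by (simp add: geometric_realization_finite)
qed

lemma geometric_realization_cone:
  assumes K: "abstract_complex K" "finite K" and apex: "{u} \<in> K" "\<And>\<sigma>. \<sigma> \<in> K \<Longrightarrow> insert u \<sigma> \<in> K"
  shows "geometric_realization K homotopy_equivalent_space discrete_topology {()}"
proof -
  let ?D = "\<Union>K - {u}"
  have "geometric_realization K homotopy_equivalent_space geometric_realization (deletion K ?D)"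
  proof (rule geometric_realization_delete_dominated_ranked[OF K,
        where rank = "\<lambda>_. 0 :: nat" and u = "\<lambda>_. u"])
    show "finite ?D" using K unfolding abstract_complex_def by blast
  qed (simp_all add: apex(2))
  also have "deletion K ?D = {{u}}"
  proof (intro equalityI subsetI)
    fix \<sigma> assume "\<sigma> \<in> deletion K ?D"
    then have "\<sigma> \<subseteq> {u}" "\<sigma> \<noteq> {}"
      using K(1) by (auto simp: deletion_def abstract_complex_def)
    then show "\<sigma> \<in> {{u}}" by blast
  qed (use apex(1) in \<open>simp add: deletion_def\<close>)
  also have "geometric_realization {{u}} homotopy_equivalent_space discrete_topology {()}"
    unfolding geometric_realization_singleton by (rule singleton_homotopy_equivalent_point)
  finally show ?thesis .
qed

section \<open>Cross-polytopes\<close>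

definition normalize_by :: "(('i \<Rightarrow> real) \<Rightarrow> real) \<Rightarrow> ('i \<Rightarrow> real) \<Rightarrow> 'i \<Rightarrow> real" where
  "normalize_by q y = (\<lambda>i. inverse (q y) * y i)"

lemma normalize_by_unit_sphere:
  fixes p q :: "('i \<Rightarrow> real) \<Rightarrow> real"
  assumes cont: "continuous_on C q" and pos: "\<And>y. y \<in> C \<Longrightarrow> 0 < q y"
    and homogeneous: "\<And>c y. 0 < c \<Longrightarrow> p (\<lambda>i. c * y i) = c * p y"
      "\<And>c y. 0 < c \<Longrightarrow> q (\<lambda>i. c * y i) = c * q y"
    and cone: "\<And>c y. 0 < c \<Longrightarrow> y \<in> C \<Longrightarrow> (\<lambda>i. c * y i) \<in> C"
  shows "continuous_on {y \<in> C. p y = 1} (normalize_by q)"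
    and "\<And>y. y \<in> {y \<in> C. p y = 1} \<Longrightarrow> normalize_by q y \<in> {y \<in> C. q y = 1}"
    and "\<And>y. y \<in> {y \<in> C. p y = 1} \<Longrightarrow> normalize_by p (normalize_by q y) = y"
proof -
  have "continuous_on {y \<in> C. p y = 1} q"
    using cont by (rule continuous_on_subset) blast
  then show "continuous_on {y \<in> C. p y = 1} (normalize_by q)"
    unfolding normalize_by_def using less_imp_neq[OF pos]
    by (intro continuous_intros) auto
  fix y assume y: "y \<in> {y \<in> C. p y = 1}"
  then have q: "0 < inverse (q y)" using pos by simp
  then show "normalize_by q y \<in> {y \<in> C. q y = 1}"
    using y homogeneous(2)[OF q, of y] cone[OF q, of y] by (simp add: normalize_by_def)
  show "normalize_by p (normalize_by q y) = y"
    using y q homogeneous(1)[OF q, of y] by (simp add: normalize_by_def mult.assoc[symmetric])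
qed

lemma homeomorphic_unit_spheres:
  fixes p q :: "('i \<Rightarrow> real) \<Rightarrow> real"
  assumes "continuous_on C p" "continuous_on C q"
    and "\<And>y. y \<in> C \<Longrightarrow> 0 < p y" "\<And>y. y \<in> C \<Longrightarrow> 0 < q y"
    and "\<And>c y. 0 < c \<Longrightarrow> p (\<lambda>i. c * y i) = c * p y" "\<And>c y. 0 < c \<Longrightarrow> q (\<lambda>i. c * y i) = c * q y"
    and "\<And>c y. 0 < c \<Longrightarrow> y \<in> C \<Longrightarrow> (\<lambda>i. c * y i) \<in> C"
  shows "top_of_set {y \<in> C. p y = 1} homeomorphic_space top_of_set {y \<in> C. q y = 1}"
proof -
  have "homeomorphic_maps (top_of_set {y \<in> C. p y = 1}) (top_of_set {y \<in> C. q y = 1})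
          (normalize_by q) (normalize_by p)"
    using normalize_by_unit_sphere[of C q p, OF assms(2,4,5,6,7)]
      normalize_by_unit_sphere[of C p q, OF assms(1,3,6,5,7)]
    by (simp add: homeomorphic_maps_def Pi_iff)
  then show ?thesis by (auto simp only: homeomorphic_space_def)
qed

definition l1_sphere :: "nat \<Rightarrow> (nat \<Rightarrow> real) set" where
  "l1_sphere m = {y. (\<Sum>i\<le>m. \<bar>y i\<bar>) = 1 \<and> (\<forall>i>m. y i = 0)}"

lemma l1_sphere_homeomorphic_nsphere: "top_of_set (l1_sphere m) homeomorphic_space nsphere m"
proof -
  define C where "C = {y :: nat \<Rightarrow> real. (\<exists>i\<le>m. y i \<noteq> 0) \<and> (\<forall>i>m. y i = 0)}"
  let ?p = "\<lambda>y :: nat \<Rightarrow> real. \<Sum>i\<le>m. \<bar>y i\<bar>" and ?q = "\<lambda>y :: nat \<Rightarrow> real. sqrt (\<Sum>i\<le>m. (y i)\<^sup>2)"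
  have "top_of_set {y \<in> C. ?p y = 1} homeomorphic_space top_of_set {y \<in> C. ?q y = 1}"
  proof (rule homeomorphic_unit_spheres)
    show "continuous_on C ?p" "continuous_on C ?q" by (intro continuous_intros)+
    fix y assume "y \<in> C"
    then obtain i where "i \<in> {..m}" "y i \<noteq> 0" by (auto simp: C_def)
    then show "0 < ?p y" "0 < ?q y" by (auto intro!: sum_pos2[of _ i] simp del: atMost_iff)
  next
    fix c :: real and y :: "nat \<Rightarrow> real" assume c: "0 < c"
    show "?p (\<lambda>i. c * y i) = c * ?p y"
      using c by (simp add: abs_mult sum_distrib_left)
    show "?q (\<lambda>i. c * y i) = c * ?q y"
      using c by (simp add: power_mult_distrib sum_distrib_left[symmetric] real_sqrt_mult)
    show "(\<lambda>i. c * y i) \<in> C" if "y \<in> C"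
      using that c by (auto simp: C_def)
  qed
  moreover have "{y \<in> C. ?p y = 1} = l1_sphere m"
    by (auto simp: C_def l1_sphere_def)
       (metis (no_types, lifting) abs_zero atMost_iff sum.neutral zero_neq_one)
  moreover have "{y \<in> C. ?q y = 1} = {y. (\<Sum>i\<le>m. (y i)\<^sup>2) = 1 \<and> (\<forall>i>m. y i = 0)}"
    by (auto simp: C_def)
       (metis (no_types, lifting) atMost_iff sum.neutral zero_neq_one zero_power2)
  moreover have "nsphere m = top_of_set {y. (\<Sum>i\<le>m. (y i)\<^sup>2) = 1 \<and> (\<forall>i>m. y i = 0)}"
    by (simp add: nsphere euclidean_product_topology)
  ultimately show ?thesis by simp
qed

definition cross_polytope_boundary :: "nat \<Rightarrow> (nat \<times> bool) set set" where
  "cross_polytope_boundary m = {\<sigma>. \<sigma> \<noteq> {} \<and> \<sigma> \<subseteq> {..m} \<times> UNIV \<and> inj_on fst \<sigma>}"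

lemma finite_cross_polytope_boundary: "finite (cross_polytope_boundary m)"
  by (rule finite_subset[of _ "Pow ({..m} \<times> UNIV)"]) (auto simp: cross_polytope_boundary_def)

lemma abstract_complex_cross_polytope_boundary: "abstract_complex (cross_polytope_boundary m)"
  unfolding abstract_complex_def cross_polytope_boundary_def
  by (auto intro: finite_subset[of _ "{..m} \<times> UNIV"] inj_on_subset)

lemma inj_on_fst_iff:
  "inj_on fst (\<sigma> :: ('a \<times> bool) set) \<longleftrightarrow> (\<forall>i. (i, True) \<notin> \<sigma> \<or> (i, False) \<notin> \<sigma>)"
proof
  assume "\<forall>i. (i, True) \<notin> \<sigma> \<or> (i, False) \<notin> \<sigma>"
  then have same_sign: "s = s'" if "(i, s) \<in> \<sigma>" "(i, s') \<in> \<sigma>" for i s s'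
    using that by (cases s; cases s') auto
  show "inj_on fst \<sigma>"
  proof (rule inj_onI)
    fix v w assume "v \<in> \<sigma>" "w \<in> \<sigma>" "fst v = fst w"
    then obtain i s s' where "v = (i, s)" "w = (i, s')" by (cases v; cases w) auto
    then show "v = w" using same_sign[of i s s'] \<open>v \<in> \<sigma>\<close> \<open>w \<in> \<sigma>\<close> by simp
  qed
qed (metis Pair_inject fst_conv inj_onD)

lemma in_cross_polytope_realization_iff:
  "x \<in> (\<Union>\<sigma>\<in>cross_polytope_boundary m. closed_simplex \<sigma>) \<longleftrightarrow>
     (\<forall>v. 0 \<le> x v) \<and> (\<forall>i>m. \<forall>s. x (i, s) = 0) \<and>
     (\<Sum>i\<le>m. x (i, True) + x (i, False)) = 1 \<and> (\<forall>i. x (i, True) = 0 \<or> x (i, False) = 0)"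
proof -
  let ?V = "{..m} \<times> (UNIV :: bool set)"
  have "sum x ?V = (\<Sum>i\<le>m. \<Sum>s\<in>UNIV. x (i, s))"
    by (simp add: sum.cartesian_product)
  also have "\<dots> = (\<Sum>i\<le>m. x (i, True) + x (i, False))"
    by (simp add: UNIV_bool add.commute)
  finally have sum_V: "sum x ?V = (\<Sum>i\<le>m. x (i, True) + x (i, False))" .
  have "inj_on fst (support x) \<longleftrightarrow> (\<forall>i. x (i, True) = 0 \<or> x (i, False) = 0)"
    by (simp add: inj_on_fst_iff support_def)
  moreover have "x \<in> closed_simplex (support x) \<and> support x \<subseteq> ?V \<longleftrightarrow> x \<in> closed_simplex ?V"
    using closed_simplex_Diff[of ?V x "?V - support x"] support_subset[of x ?V]
    by (auto simp: double_diff)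
  ultimately have "x \<in> (\<Union>\<sigma>\<in>cross_polytope_boundary m. closed_simplex \<sigma>) \<longleftrightarrow>
      x \<in> closed_simplex ?V \<and> (\<forall>i. x (i, True) = 0 \<or> x (i, False) = 0)"
    unfolding in_Union_closed_simplex_iff[OF abstract_complex_cross_polytope_boundary]
    unfolding cross_polytope_boundary_def mem_Collect_eq
    using support_subset(2)[of x "support x"] by argo
  also have "x \<in> closed_simplex ?V \<longleftrightarrow> (\<forall>v. 0 \<le> x v) \<and> (\<forall>i>m. \<forall>s. x (i, s) = 0) \<and>
      (\<Sum>i\<le>m. x (i, True) + x (i, False)) = 1"
    by (simp add: closed_simplex_def sum_V split_paired_All not_le)
  finally show ?thesis by (simp only: conj_assoc)
qed

definition signed_coordinates :: "('a \<times> bool \<Rightarrow> real) \<Rightarrow> 'a \<Rightarrow> real" where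
  "signed_coordinates x = (\<lambda>i. x (i, True) - x (i, False))"

definition signed_parts :: "('a \<Rightarrow> real) \<Rightarrow> 'a \<times> bool \<Rightarrow> real" where
  "signed_parts y = (\<lambda>(i, s). max 0 (if s then y i else - y i))"

lemma continuous_on_signed_coordinates: "continuous_on S signed_coordinates"
  unfolding signed_coordinates_def by (intro continuous_intros)

lemma continuous_on_signed_parts: "continuous_on S signed_parts"
proof (rule continuous_on_coordinatewise_then_product)
  show "continuous_on S (\<lambda>y. signed_parts y v)" for v
    unfolding signed_parts_def case_prod_beta by (cases "snd v") (simp_all add: continuous_intros)
qed

lemma signed_coordinates_cross_polytope:
  assumes "x \<in> (\<Union>\<sigma>\<in>cross_polytope_boundary m. closed_simplex \<sigma>)"
  shows "signed_coordinates x \<in> l1_sphere m" and "signed_parts (signed_coordinates x) = x"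
proof -
  have x: "0 \<le> x v" "x (i, True) = 0 \<or> x (i, False) = 0" for v i
    using assms unfolding in_cross_polytope_realization_iff by blast+
  have "\<bar>signed_coordinates x i\<bar> = x (i, True) + x (i, False)" for i
    using x(1)[of "(i, True)"] x(1)[of "(i, False)"] x(2)[of i]
    by (auto simp: signed_coordinates_def)
  then show "signed_coordinates x \<in> l1_sphere m"
    using assms unfolding in_cross_polytope_realization_iff l1_sphere_def
    by (simp add: signed_coordinates_def)
  have "signed_parts (signed_coordinates x) (i, s) = x (i, s)" for i s
    using x(1)[of "(i, True)"] x(1)[of "(i, False)"] x(2)[of i]
    by (cases s) (auto simp: signed_coordinates_def signed_parts_def)
  then show "signed_parts (signed_coordinates x) = x" by auto
qed

lemma signed_parts_l1_sphere:
  assumes "y \<in> l1_sphere m"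
  shows "signed_parts y \<in> (\<Union>\<sigma>\<in>cross_polytope_boundary m. closed_simplex \<sigma>)"
    and "signed_coordinates (signed_parts y) = y"
proof -
  have "signed_parts y (i, True) + signed_parts y (i, False) = \<bar>y i\<bar>" for i
    by (simp add: signed_parts_def)
  then show "signed_parts y \<in> (\<Union>\<sigma>\<in>cross_polytope_boundary m. closed_simplex \<sigma>)"
    using assms unfolding in_cross_polytope_realization_iff l1_sphere_def
    by (auto simp: signed_parts_def)
  show "signed_coordinates (signed_parts y) = y"
    by (auto simp: signed_coordinates_def signed_parts_def)
qed

lemma cross_polytope_boundary_homeomorphic_l1_sphere:
  "geometric_realization (cross_polytope_boundary m) homeomorphic_space top_of_set (l1_sphere m)"
proof -
  have "homeomorphic_maps (geometric_realization (cross_polytope_boundary m))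
          (top_of_set (l1_sphere m)) signed_coordinates signed_parts"
    unfolding geometric_realization_finite[OF finite_cross_polytope_boundary]
    using signed_coordinates_cross_polytope[of _ m] signed_parts_l1_sphere[of _ m]
    by (simp add: homeomorphic_maps_def continuous_on_signed_coordinates
        continuous_on_signed_parts Pi_iff del: UN_iff)
  then show ?thesis by (auto simp only: homeomorphic_space_def)
qed

lemma cross_polytope_boundary_homeomorphic_nsphere:
  "geometric_realization (cross_polytope_boundary m) homeomorphic_space nsphere m"
  by (rule homeomorphic_space_trans[OF cross_polytope_boundary_homeomorphic_l1_sphere
        l1_sphere_homeomorphic_nsphere])

section \<open>Independence complexes\<close>

definition independence_complex :: "'a set \<Rightarrow> ('a \<Rightarrow> 'a \<Rightarrow> bool) \<Rightarrow> 'a set set" where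
  "independence_complex X R =
     {\<sigma>. finite \<sigma> \<and> \<sigma> \<noteq> {} \<and> \<sigma> \<subseteq> X \<and> (\<forall>a\<in>\<sigma>. \<forall>b\<in>\<sigma>. \<not> R a b)}"

lemma abstract_complex_independence_complex: "abstract_complex (independence_complex X R)"
  unfolding abstract_complex_def independence_complex_def by (auto intro: finite_subset)

lemma finite_independence_complex: "finite X \<Longrightarrow> finite (independence_complex X R)"
  by (rule finite_subset[of _ "Pow X"]) (auto simp: independence_complex_def)

lemma deletion_independence_complex:
  "deletion (independence_complex X R) D = independence_complex (X - D) R"
  by (auto simp: deletion_def independence_complex_def)

lemma independence_complex_image:
  assumes inj: "inj_on f X" and R_iff: "\<And>x y. x \<in> X \<Longrightarrow> y \<in> X \<Longrightarrow> R (f x) (f y) \<longleftrightarrow> S x y"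
  shows "independence_complex (f ` X) R = image f ` independence_complex X S"
proof (intro equalityI subsetI)
  fix \<sigma> assume \<sigma>: "\<sigma> \<in> independence_complex (f ` X) R"
  then obtain \<tau> where \<tau>: "\<tau> \<subseteq> X" "\<sigma> = f ` \<tau>"
    by (auto simp: independence_complex_def subset_image_iff)
  then have "finite \<tau>" "\<tau> \<noteq> {}"
    using \<sigma> inj_on_subset[OF inj \<tau>(1)] by (auto simp: independence_complex_def dest: finite_imageD)
  moreover have "\<not> S a b" if "a \<in> \<tau>" "b \<in> \<tau>" for a b
    using that \<sigma> \<tau> R_iff[of a b] by (auto simp: independence_complex_def)
  ultimately show "\<sigma> \<in> image f ` independence_complex X S"
    using \<tau> by (auto simp: independence_complex_def)
next
  fix \<sigma> assume "\<sigma> \<in> image f ` independence_complex X S"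
  then show "\<sigma> \<in> independence_complex (f ` X) R"
    using R_iff by (fastforce simp: independence_complex_def subset_iff)
qed

lemma independence_complex_image_homeomorphic:
  assumes "inj_on f X" and "\<And>x y. x \<in> X \<Longrightarrow> y \<in> X \<Longrightarrow> R (f x) (f y) \<longleftrightarrow> S x y"
  shows "geometric_realization (independence_complex (f ` X) R)
           homeomorphic_space geometric_realization (independence_complex X S)"
proof -
  have "inj_on f (\<Union>(independence_complex X S))"
    using assms(1) by (rule inj_on_subset) (auto simp: independence_complex_def)
  then show ?thesis
    by (simp add: independence_complex_image[where R = R and S = S, OF assms]
        geometric_realization_image)
qed

lemma independent_insert_dominating:
  assumes R: "symp R" and u: "u \<in> X"
    and dominating: "\<And>w. w \<in> X \<Longrightarrow> R u w \<Longrightarrow> R v w \<or> w \<in> D"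
    and \<sigma>: "\<sigma> \<in> independence_complex X R" "v \<in> \<sigma>" "\<sigma> \<inter> D = {}" and "u \<notin> D"
  shows "insert u \<sigma> \<in> independence_complex X R"
proof -
  have indep: "\<not> R a b" if "a \<in> \<sigma>" "b \<in> \<sigma>" for a b
    using \<sigma>(1) that by (simp add: independence_complex_def)
  have "\<sigma> \<subseteq> X" using \<sigma>(1) by (simp add: independence_complex_def)
  have not_adjacent: "\<not> R u w" if "w \<in> \<sigma>" for w
    using dominating[of w] indep[OF \<sigma>(2) that] \<sigma>(3) that \<open>\<sigma> \<subseteq> X\<close> by blast
  moreover have "\<not> R u u"
    using dominating[of u] u \<open>u \<notin> D\<close> not_adjacent[OF \<sigma>(2)] sympD[OF R] by blast
  ultimately show ?thesis
    using \<sigma>(1) u sympD[OF R] by (auto simp: independence_complex_def)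
qed

lemma independence_complex_fold:
  fixes rank :: "'a \<Rightarrow> 'b::linorder"
  assumes X: "finite X" and R: "symp R" and D: "D \<subseteq> X"
    and fold: "\<And>v. v \<in> D \<Longrightarrow>
           \<exists>u\<in>X - D. \<forall>w\<in>X. R u w \<longrightarrow> R v w \<or> w \<in> D \<and> rank w < rank v"
  shows "geometric_realization (independence_complex X R)
           homotopy_equivalent_space geometric_realization (independence_complex (X - D) R)"
proof -
  have "\<forall>v\<in>D. \<exists>u. u \<in> X - D \<and> (\<forall>w\<in>X. R u w \<longrightarrow> R v w \<or> w \<in> D \<and> rank w < rank v)"
    using fold by blast
  from bchoice[OF this] obtain u where u: "\<And>v. v \<in> D \<Longrightarrow> u v \<in> X - D"
    and dominating: "\<And>v w. v \<in> D \<Longrightarrow> w \<in> X \<Longrightarrow> R (u v) w \<Longrightarrow> R v w \<or> w \<in> D \<and> rank w < rank v"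
    by auto
  show ?thesis
    unfolding deletion_independence_complex[symmetric]
  proof (rule geometric_realization_delete_dominated_ranked[where rank = rank and u = u])
    show "abstract_complex (independence_complex X R)"
      by (rule abstract_complex_independence_complex)
    show "finite (independence_complex X R)" by (rule finite_independence_complex[OF X])
    show "finite D" using D X by (rule finite_subset)
    show "u v \<notin> D" if "v \<in> D" for v using u[OF that] by blast
    fix v \<sigma>
    assume \<sigma>: "\<sigma> \<in> independence_complex X R" "v \<in> \<sigma> \<inter> D" "\<forall>w\<in>\<sigma> \<inter> D. rank v \<le> rank w"
    show "insert (u v) \<sigma> \<in> independence_complex X R"
    proof (rule independent_insert_dominating[OF R])
      show "\<sigma> \<inter> {w \<in> D. rank w < rank v} = {}" using \<sigma>(3) by force
      show "R v w \<or> w \<in> {w \<in> D. rank w < rank v}" if "w \<in> X" "R (u v) w" for w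
        using dominating[OF _ that] \<sigma>(2) by blast
    qed (use \<sigma> u[of v] in auto)
  qed
qed

lemma independence_complex_isolated:
  assumes X: "finite X" and R: "symp R" and u: "u \<in> X" and isolated: "\<And>w. w \<in> X \<Longrightarrow> \<not> R u w"
  shows "geometric_realization (independence_complex X R)
           homotopy_equivalent_space discrete_topology {()}"
proof (rule geometric_realization_cone)
  show "abstract_complex (independence_complex X R)"
    by (rule abstract_complex_independence_complex)
  show "finite (independence_complex X R)" by (rule finite_independence_complex[OF X])
  show "{u} \<in> independence_complex X R" using u isolated by (simp add: independence_complex_def)
  have "\<not> R w u" if "w \<in> X" for w
    using isolated[OF that] sympD[OF R] by blast
  then show "insert u \<sigma> \<in> independence_complex X R" if "\<sigma> \<in> independence_complex X R" for \<sigma>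
    using that u isolated by (auto simp: independence_complex_def subset_iff)
qed

lemma cross_polytope_boundary_eq_independence_complex:
  "cross_polytope_boundary m =
     independence_complex ({..m} \<times> UNIV) (\<lambda>v w. v \<noteq> w \<and> fst v = fst w)"
  by (auto simp: cross_polytope_boundary_def independence_complex_def inj_on_def
      intro: finite_subset[of _ "{..m} \<times> UNIV"])

definition one_regular :: "'a set \<Rightarrow> ('a \<Rightarrow> 'a \<Rightarrow> bool) \<Rightarrow> bool" where
  "one_regular X R \<longleftrightarrow> symp R \<and> irreflp R \<and> (\<forall>x\<in>X. \<exists>!y. y \<in> X \<and> R x y)"

lemma one_regular_mate:
  assumes "one_regular X R"
  obtains mate where "\<And>x. x \<in> X \<Longrightarrow> mate x \<in> X" "\<And>x. x \<in> X \<Longrightarrow> mate x \<noteq> x"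
    "\<And>x. x \<in> X \<Longrightarrow> mate (mate x) = x" "\<And>x y. x \<in> X \<Longrightarrow> y \<in> X \<Longrightarrow> R x y \<longleftrightarrow> y = mate x"
proof -
  define mate where "mate x = (THE y. y \<in> X \<and> R x y)" for x
  have mate: "mate x \<in> X \<and> R x (mate x)" if "x \<in> X" for x
    unfolding mate_def by (rule theI') (use assms that in \<open>simp add: one_regular_def\<close>)
  then have iff: "R x y \<longleftrightarrow> y = mate x" if "x \<in> X" "y \<in> X" for x y
    using assms that unfolding one_regular_def by metis
  moreover have "mate x \<noteq> x" if "x \<in> X" for x
    using assms mate[OF that] unfolding one_regular_def by (metis irreflpD)
  moreover have "mate (mate x) = x" if "x \<in> X" for x
    using assms mate that iff[of "mate x" x] unfolding one_regular_def by (metis sympD)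
  ultimately show thesis using that mate by blast
qed

lemma involution_pairs:
  assumes X: "finite X" "card X = 2 * n"
    and mate: "\<And>x. x \<in> X \<Longrightarrow> mate x \<in> X" "\<And>x. x \<in> X \<Longrightarrow> mate x \<noteq> x" "\<And>x. x \<in> X \<Longrightarrow> mate (mate x) = x"
  obtains a where "(\<Union>i<n. {a i, mate (a i)}) = X"
proof -
  define E where "E = (\<lambda>x. {x, mate x}) ` X"
  have E: "finite E" "\<Union>E = X" using X(1) mate(1) by (auto simp: E_def)
  have pair: "e = {z, mate z}" if "e \<in> E" "z \<in> e" for e z
    using that mate(3) by (auto simp: E_def)
  have "2 * card E = card (\<Union>E)"
  proof (rule card_partition)
    show "finite E" "finite (\<Union>E)" using E X(1) by simp_all
    show "card e = 2" if "e \<in> E" for e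
    proof -
      obtain x where "x \<in> X" "e = {x, mate x}" using \<open>e \<in> E\<close> by (auto simp: E_def)
      then show ?thesis using mate(2)[of x] by (simp add: card_insert_if eq_commute)
    qed
    show "e \<inter> e' = {}" if "e \<in> E" "e' \<in> E" "e \<noteq> e'" for e e'
      using pair[OF that(1)] pair[OF that(2)] that(3) by (metis disjoint_iff)
  qed
  then have "card E = n" using E(2) X(2) by simp
  then obtain h where h: "bij_betw h {..<n} E"
    using ex_bij_betw_nat_finite[OF E(1)] by (auto simp: atLeast0LessThan)
  then have "\<forall>i\<in>{..<n}. \<exists>x. h i = {x, mate x}"
    using bij_betwE[OF h] by (auto simp: E_def)
  from bchoice[OF this] obtain a where "\<forall>i\<in>{..<n}. h i = {a i, mate (a i)}" by blast
  then have "(\<Union>i<n. {a i, mate (a i)}) = \<Union>(h ` {..<n})" by simp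
  also have "\<dots> = X" using bij_betw_imp_surj_on[OF h] E(2) by simp
  finally show thesis by (rule that)
qed

lemma one_regular_pairing:
  assumes X: "finite X" "card X = 2 * n" and R: "one_regular X R"
  obtains \<phi> where "bij_betw \<phi> ({..<n} \<times> (UNIV :: bool set)) X"
    and "\<And>v w. v \<in> {..<n} \<times> UNIV \<Longrightarrow> w \<in> {..<n} \<times> UNIV \<Longrightarrow>
           R (\<phi> v) (\<phi> w) \<longleftrightarrow> v \<noteq> w \<and> fst v = fst w"
proof (rule one_regular_mate[OF R])
  fix mate
  assume mate: "\<And>x. x \<in> X \<Longrightarrow> mate x \<in> X" "\<And>x. x \<in> X \<Longrightarrow> mate x \<noteq> x" "\<And>x. x \<in> X \<Longrightarrow> mate (mate x) = x"
    and R_iff: "\<And>x y. x \<in> X \<Longrightarrow> y \<in> X \<Longrightarrow> R x y \<longleftrightarrow> y = mate x"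
  let ?V = "{..<n} \<times> (UNIV :: bool set)"
  obtain a where a: "(\<Union>i<n. {a i, mate (a i)}) = X"
    by (rule involution_pairs[OF X mate])
  define \<phi> where "\<phi> v = (if snd v then a (fst v) else mate (a (fst v)))" for v :: "nat \<times> bool"
  have surj: "\<phi> ` ?V = X"
  proof -
    have "\<phi> ` ?V = (\<Union>i<n. {\<phi> (i, True), \<phi> (i, False)})"
      by (auto simp: UNIV_bool)
    then show ?thesis using a by (simp add: \<phi>_def)
  qed
  moreover have inj: "inj_on \<phi> ?V"
    by (rule eq_card_imp_inj_on) (use surj X in \<open>simp_all add: card_cartesian_product\<close>)
  moreover have "R (\<phi> v) (\<phi> w) \<longleftrightarrow> v \<noteq> w \<and> fst v = fst w" if v: "v \<in> ?V" and w: "w \<in> ?V" for v w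
  proof -
    have "\<phi> v \<in> X" "\<phi> w \<in> X" "a (fst v) \<in> X" using v w a surj by auto
    then have "R (\<phi> v) (\<phi> w) \<longleftrightarrow> \<phi> w = \<phi> (fst v, \<not> snd v)"
      using mate(3)[of "a (fst v)"] by (simp add: R_iff \<phi>_def)
    also have "\<dots> \<longleftrightarrow> w = (fst v, \<not> snd v)"
      using v w by (intro inj_on_eq_iff[OF inj]) auto
    finally show ?thesis by (cases v; cases w) auto
  qed
  ultimately show thesis by (intro that[of \<phi>]) (simp_all add: bij_betw_def)
qed

lemma independence_complex_one_regular:
  assumes X: "finite X" "card X = 2 * Suc m" and R: "one_regular X R"
  shows "geometric_realization (independence_complex X R) homeomorphic_space nsphere m"
proof -
  obtain \<phi> where "bij_betw \<phi> ({..<Suc m} \<times> (UNIV :: bool set)) X"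
    and R_\<phi>: "\<And>v w. v \<in> {..<Suc m} \<times> UNIV \<Longrightarrow> w \<in> {..<Suc m} \<times> UNIV \<Longrightarrow>
           R (\<phi> v) (\<phi> w) \<longleftrightarrow> v \<noteq> w \<and> fst v = fst w"
    using one_regular_pairing[OF X R] by blast
  then have \<phi>: "inj_on \<phi> ({..m} \<times> UNIV)" "\<phi> ` ({..m} \<times> UNIV) = X"
    by (auto simp: bij_betw_def lessThan_Suc_atMost)
  have "geometric_realization (independence_complex (\<phi> ` ({..m} \<times> UNIV)) R)
          homeomorphic_space geometric_realization (cross_polytope_boundary m)"
    unfolding cross_polytope_boundary_eq_independence_complex
    using R_\<phi> unfolding lessThan_Suc_atMost
    by (intro independence_complex_image_homeomorphic[OF \<phi>(1)])
  then show ?thesis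
    unfolding \<phi>(2)
    by (rule homeomorphic_space_trans[OF _ cross_polytope_boundary_homeomorphic_nsphere])
qed

locale graph_with_path_component =
  fixes Y :: "'a set" and R :: "'a \<Rightarrow> 'a \<Rightarrow> bool" and p :: "nat \<Rightarrow> 'a" and m :: nat
  assumes finite_rest: "finite Y" and symp: "symp R" and inj_path: "inj_on p {..<m}"
    and path_disjoint: "i < m \<Longrightarrow> p i \<notin> Y"
    and path_adjacent_iff: "i < m \<Longrightarrow> j < m \<Longrightarrow> R (p i) (p j) \<longleftrightarrow> j = Suc i \<or> i = Suc j"
    and path_not_adjacent_rest: "i < m \<Longrightarrow> y \<in> Y \<Longrightarrow> \<not> R (p i) y"
begin

definition kept :: "nat set" where
  "kept = {i. i < m \<and> i mod 3 \<noteq> 2}"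

lemma path_vertex_dominated:
  assumes i: "i < m" "i mod 3 = 2" and w: "w \<in> p ` {..<m} \<union> Y" "R (p (i - 2)) w"
  shows "R (p i) w \<or> (\<exists>j<i. w = p j \<and> j mod 3 = 2)"
proof -
  define k where "k = i - 2"
  have "2 \<le> i" using i(2) by (cases "i < 2") auto
  then have k: "i = Suc (Suc k)" "k < m" using i(1) by (simp_all add: k_def)
  have "w \<notin> Y" using path_not_adjacent_rest[OF k(2)] w(2) by (auto simp: k_def)
  then obtain j where j: "j < m" "w = p j" "j = Suc k \<or> k = Suc j"
    using w path_adjacent_iff[OF k(2)] by (auto simp: k_def)
  from j(3) show ?thesis
  proof
    assume "j = Suc k"
    then show ?thesis using i(1) j(1,2) k(1) by (simp add: path_adjacent_iff)
  next
    assume "k = Suc j"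
    then have "i = j + 3" using k(1) by simp
    then show ?thesis using i(2) j(2) by auto
  qed
qed

text \<open>
  The path is folded from its end: \<open>p i\<close> with \<open>i mod 3 = 2\<close> is dominated by \<open>p (i - 2)\<close> once
  \<open>p (i - 3)\<close> has been deleted.
\<close>

lemma independence_complex_kept:
  "geometric_realization (independence_complex (p ` {..<m} \<union> Y) R)
     homotopy_equivalent_space geometric_realization (independence_complex (p ` kept \<union> Y) R)"
proof -
  define D where "D = p ` {i. i < m \<and> i mod 3 = 2}"
  have p_in_D: "p i \<in> D \<longleftrightarrow> i mod 3 = 2" if "i < m" for i
    using that inj_path by (auto simp: D_def inj_on_def)
  have rank: "inv_into {..<m} p (p i) = i" if "i < m" for i
    using that inj_path by simp
  have "geometric_realization (independence_complex (p ` {..<m} \<union> Y) R) homotopy_equivalent_space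
      geometric_realization (independence_complex (p ` {..<m} \<union> Y - D) R)"
  proof (rule independence_complex_fold[where rank = "inv_into {..<m} p"])
    show "finite (p ` {..<m} \<union> Y)" using finite_rest by simp
    show "symp R" by (rule symp)
    show "D \<subseteq> p ` {..<m} \<union> Y" by (auto simp: D_def)
    fix v assume "v \<in> D"
    then obtain i where i: "i < m" "i mod 3 = 2" "v = p i" by (auto simp: D_def)
    have "2 \<le> i" using i(2) by (cases "i < 2") auto
    then have "(i - 2) mod 3 = 0" using i(2) mod_eq_dvd_iff_nat[of 2 i 3] by simp
    then have "p (i - 2) \<in> p ` {..<m} \<union> Y - D" using i(1) p_in_D[of "i - 2"] by auto
    moreover have "R v w \<or> w \<in> D \<and> inv_into {..<m} p w < inv_into {..<m} p v"
      if "w \<in> p ` {..<m} \<union> Y" "R (p (i - 2)) w" for w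
      using path_vertex_dominated[OF i(1,2) that] i(1,3) p_in_D rank by auto
    ultimately show "\<exists>u\<in>p ` {..<m} \<union> Y - D. \<forall>w\<in>p ` {..<m} \<union> Y. R u w \<longrightarrow>
        R v w \<or> w \<in> D \<and> inv_into {..<m} p w < inv_into {..<m} p v"
      by blast
  qed
  moreover have "p ` {..<m} - D = p ` kept" using p_in_D by (auto simp: kept_def)
  moreover have "Y - D = Y" using path_disjoint by (auto simp: D_def)
  ultimately show ?thesis by (simp add: Un_Diff)
qed

lemma independence_complex_contractible:
  assumes "m mod 3 = 1"
  shows "geometric_realization (independence_complex (p ` {..<m} \<union> Y) R)
           homotopy_equivalent_space discrete_topology {()}"
proof (rule homotopy_eqv_trans[OF independence_complex_kept independence_complex_isolated])
  define k where "k = m - 1"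
  have k: "k < m" "Suc k = m" "k mod 3 = 0" using assms unfolding k_def by presburger+
  show "finite (p ` kept \<union> Y)" using finite_rest by (simp add: kept_def)
  show "symp R" by (rule symp)
  show "p k \<in> p ` kept \<union> Y" using k(1,3) by (simp add: kept_def)
  fix w assume "w \<in> p ` kept \<union> Y"
  then show "\<not> R (p k) w"
  proof
    assume "w \<in> p ` kept"
    then obtain j where j: "w = p j" "j < m" "j mod 3 \<noteq> 2" by (auto simp: kept_def)
    then have "k \<noteq> Suc j" "j \<noteq> Suc k" using k by presburger+
    then show ?thesis using j(1,2) k(1) by (simp add: path_adjacent_iff)
  next
    assume "w \<in> Y"
    then show ?thesis by (rule path_not_adjacent_rest[OF k(1)])
  qed
qed

lemma card_kept:
  assumes "m mod 3 \<noteq> 1"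
  shows "card kept = 2 * ((m + 1) div 3)"
proof -
  let ?A = "{..<(m + 1) div 3} \<times> {..<2 :: nat}"
  have kept_iff: "i \<in> kept \<longleftrightarrow> i div 3 < (m + 1) div 3 \<and> i mod 3 < 2" for i
  proof -
    have "m mod 3 = 0 \<or> m mod 3 = 2" using assms mod_less_divisor[of 3 m] by linarith
    then consider "m = 3 * (m div 3)" "(m + 1) div 3 = m div 3"
      | "m = 3 * (m div 3) + 2" "(m + 1) div 3 = m div 3 + 1"
      using mult_div_mod_eq[of 3 m] by linarith
    moreover have "i = 3 * (i div 3) + i mod 3" "i mod 3 < 3" by simp_all
    ultimately show ?thesis unfolding kept_def mem_Collect_eq by cases linarith+
  qed
  have "bij_betw (\<lambda>i. (i div 3, i mod 3)) kept ?A"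
    by (rule bij_betwI[where g = "\<lambda>(a, b). 3 * a + b"]) (auto simp: kept_iff)
  then show ?thesis by (simp add: bij_betw_same_card card_cartesian_product)
qed

lemma kept_unique_neighbour:
  assumes "m mod 3 \<noteq> 1" and i: "i \<in> kept"
  shows "\<exists>!j. j \<in> kept \<and> (j = Suc i \<or> i = Suc j)"
proof -
  have "i mod 3 = 0 \<or> i mod 3 = 1"
    using i mod_less_divisor[of 3 i] unfolding kept_def by (simp, linarith)
  then show ?thesis
  proof
    assume "i mod 3 = 0"
    then have "Suc i \<noteq> m" "Suc i mod 3 = 1" using assms(1) by (auto simp: mod_Suc)
    then have "Suc i \<in> kept" using i by (simp add: kept_def)
    moreover have "j \<notin> kept" if "i = Suc j" for j
      using \<open>i mod 3 = 0\<close> that by (auto simp: kept_def mod_Suc split: if_splits)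
    ultimately show ?thesis by (intro ex1I[of _ "Suc i"]) auto
  next
    assume "i mod 3 = 1"
    then obtain k where k: "i = Suc k" by (cases i) auto
    then have "k \<in> kept"
      using i \<open>i mod 3 = 1\<close> by (auto simp: kept_def mod_Suc split: if_splits)
    moreover have "Suc i \<notin> kept"
      using \<open>i mod 3 = 1\<close> by (simp add: kept_def mod_Suc)
    ultimately show ?thesis using k by (intro ex1I[of _ k]) auto
  qed
qed

lemma kept_path_unique_neighbour:
  assumes "m mod 3 \<noteq> 1" and i: "i \<in> kept"
  shows "\<exists>!y. y \<in> p ` kept \<union> Y \<and> R (p i) y"
proof -
  have "i < m" using i by (simp add: kept_def)
  from kept_unique_neighbour[OF assms] obtain j where j: "j \<in> kept" "j = Suc i \<or> i = Suc j"
    and unique: "\<forall>k. k \<in> kept \<and> (k = Suc i \<or> i = Suc k) \<longrightarrow> k = j"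
    by (elim ex1E conjE)
  show ?thesis
  proof (rule ex1I[of _ "p j"])
    have "j < m" using j(1) by (simp add: kept_def)
    then show "p j \<in> p ` kept \<union> Y \<and> R (p i) (p j)"
      using j path_adjacent_iff[OF \<open>i < m\<close>] by simp
    fix y assume y: "y \<in> p ` kept \<union> Y \<and> R (p i) y"
    then obtain k where k: "y = p k" "k \<in> kept"
      using path_not_adjacent_rest[OF \<open>i < m\<close>] by auto
    then have "k = Suc i \<or> i = Suc k"
      using path_adjacent_iff[OF \<open>i < m\<close>, of k] y by (simp add: kept_def)
    then show "y = p j" using k unique by simp
  qed
qed

lemma one_regular_kept:
  assumes Y: "one_regular Y R" and "m mod 3 \<noteq> 1"
  shows "one_regular (p ` kept \<union> Y) R"
  unfolding one_regular_def
proof (intro conjI ballI)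
  show "symp R" "irreflp R" using Y by (simp_all add: one_regular_def)
  fix x assume "x \<in> p ` kept \<union> Y"
  then show "\<exists>!y. y \<in> p ` kept \<union> Y \<and> R x y"
  proof
    assume "x \<in> p ` kept"
    then obtain i where "i \<in> kept" "x = p i" by blast
    then show ?thesis using kept_path_unique_neighbour[OF assms(2)] by simp
  next
    assume x: "x \<in> Y"
    have "\<not> R x (p i)" if "i \<in> kept" for i
    proof
      assume "R x (p i)"
      then have "R (p i) x" by (rule sympD[OF symp])
      then show False using path_not_adjacent_rest[OF _ x] that by (simp add: kept_def)
    qed
    then have "y \<in> p ` kept \<union> Y \<and> R x y \<longleftrightarrow> y \<in> Y \<and> R x y" for y by auto
    then show ?thesis using Y x by (simp add: one_regular_def)
  qed
qed

lemma independence_complex_nsphere: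
  assumes Y: "one_regular Y R" and "m mod 3 \<noteq> 1" and d: "card Y + 2 * ((m + 1) div 3) = 2 * Suc d"
  shows "geometric_realization (independence_complex (p ` {..<m} \<union> Y) R)
           homotopy_equivalent_space nsphere d"
proof -
  have "card (p ` kept \<union> Y) = card (p ` kept) + card Y"
    using finite_rest path_disjoint by (intro card_Un_disjoint) (auto simp: kept_def)
  also have "card (p ` kept) = card kept"
    using inj_path by (intro card_image) (auto simp: kept_def elim: inj_on_subset)
  finally have "card (p ` kept \<union> Y) = 2 * Suc d" using d card_kept[OF assms(2)] by simp
  moreover have "finite (p ` kept \<union> Y)" using finite_rest by (simp add: kept_def)
  ultimately show ?thesis
    using one_regular_kept[OF Y assms(2)]
    by (intro homotopy_eqv_trans[OF independence_complex_kept]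
        homeomorphic_imp_homotopy_equivalent_space independence_complex_one_regular)
qed

end

section \<open>Morse complexes of forests\<close>

text \<open>
  A pair \<open>(v, {v, w})\<close> of a discrete vector field is encoded by the arc \<open>(v, w)\<close>.
\<close>

definition arcs :: "'a set set \<Rightarrow> ('a \<times> 'a) set" where
  "arcs G = {(v, w). {v, w} \<in> edges G}"

definition arc_conflict :: "'a \<times> 'a \<Rightarrow> 'a \<times> 'a \<Rightarrow> bool" where
  "arc_conflict a b \<longleftrightarrow> a \<noteq> b \<and> (fst a = fst b \<or> b = prod.swap a)"

definition arc_pair :: "'a \<times> 'a \<Rightarrow> 'a \<times> 'a set" where
  "arc_pair = (\<lambda>(v, w). (v, {v, w}))"

lemma symp_arc_conflict: "symp arc_conflict"
  by (auto simp: symp_def arc_conflict_def)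

lemma irreflp_arc_conflict: "irreflp arc_conflict"
  by (simp add: irreflp_def arc_conflict_def)

lemma one_regular_arc_conflict:
  assumes inj: "inj_on fst A" and "sym A" "irrefl A"
  shows "one_regular A arc_conflict"
  unfolding one_regular_def
proof (intro conjI ballI)
  show "symp arc_conflict" by (rule symp_arc_conflict)
  show "irreflp arc_conflict" by (rule irreflp_arc_conflict)
  fix a assume a: "a \<in> A"
  have "arc_conflict a b \<longleftrightarrow> b = prod.swap a" if "b \<in> A" for b
  proof
    assume "arc_conflict a b"
    then show "b = prod.swap a"
      using inj_onD[OF inj _ a that] by (auto simp: arc_conflict_def)
  next
    have "fst a \<noteq> snd a" using a \<open>irrefl A\<close> unfolding irrefl_def by (metis prod.collapse)
    then show "b = prod.swap a \<Longrightarrow> arc_conflict a b"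
      by (cases a) (simp add: arc_conflict_def)
  qed
  moreover have "prod.swap a \<in> A" using a \<open>sym A\<close> by (cases a) (auto dest: symD)
  ultimately show "\<exists>!b. b \<in> A \<and> arc_conflict a b" by (intro ex1I[of _ "prod.swap a"]) auto
qed

lemma arcs_commute: "(v, w) \<in> arcs G \<longleftrightarrow> (w, v) \<in> arcs G"
  by (simp add: arcs_def insert_commute)

lemma arcs_irrefl: "(v, v) \<notin> arcs G"
  by (simp add: arcs_def edges_def)

lemma finite_arcs:
  assumes "finite G"
  shows "finite (arcs G)"
proof (rule finite_subset)
  show "arcs G \<subseteq> \<Union>(edges G) \<times> \<Union>(edges G)" by (auto simp: arcs_def)
  have "finite e" if "e \<in> edges G" for e
    using that by (simp add: edges_def card_ge_0_finite)
  moreover have "finite (edges G)" using assms by (simp add: edges_def)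
  ultimately have "finite (\<Union>(edges G))" by blast
  then show "finite (\<Union>(edges G) \<times> \<Union>(edges G))" by simp
qed

lemma inj_arc_pair: "inj arc_pair"
  by (auto simp: inj_def arc_pair_def doubleton_eq_iff)

definition arc_field :: "'a \<times> 'a \<Rightarrow> ('a \<times> 'a set) set" where
  "arc_field a = {arc_pair a}"

lemma inj_arc_field: "inj arc_field"
  using inj_arc_pair by (simp add: inj_def arc_field_def)

lemma arc_pair_conflict_iff:
  "arc_pair a \<noteq> arc_pair b \<and>
     (fst (arc_pair a) = fst (arc_pair b) \<or> snd (arc_pair a) = snd (arc_pair b)) \<longleftrightarrow>
   arc_conflict a b"
  unfolding inj_eq[OF inj_arc_pair]
  by (cases a; cases b) (auto simp: arc_conflict_def arc_pair_def doubleton_eq_iff)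

lemma arc_pair_image_arcs: "arc_pair ` arcs G = {(v, e). e \<in> edges G \<and> v \<in> e}"
proof (intro equalityI subsetI)
  fix p assume "p \<in> {(v, e). e \<in> edges G \<and> v \<in> e}"
  then obtain v e where p: "p = (v, e)" "e \<in> edges G" "v \<in> e" by blast
  then obtain w where "e = {v, w}" by (auto simp: edges_def card_2_iff)
  then show "p \<in> arc_pair ` arcs G"
    using p by (intro image_eqI[of _ _ "(v, w)"]) (auto simp: arc_pair_def arcs_def)
qed (auto simp: arc_pair_def arcs_def)

lemma discrete_vector_field_arc_pair_iff:
  assumes G: "abstract_complex G" and A: "A \<subseteq> arcs G"
  shows "discrete_vector_field G (arc_pair ` A) \<longleftrightarrow> (\<forall>a\<in>A. \<forall>b\<in>A. \<not> arc_conflict a b)"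
proof -
  have "\<forall>(v, e)\<in>arc_pair ` arcs G. {v} \<in> G \<and> e \<in> edges G \<and> v \<in> e"
    unfolding arc_pair_image_arcs using G by (auto simp: abstract_complex_def edges_def)
  then have "\<forall>(v, e)\<in>arc_pair ` A. {v} \<in> G \<and> e \<in> edges G \<and> v \<in> e"
    using A by blast
  moreover have "inj_on fst (arc_pair ` A) \<and> inj_on snd (arc_pair ` A) \<longleftrightarrow>
      (\<forall>a\<in>A. \<forall>b\<in>A. \<not> arc_conflict a b)"
    unfolding arc_pair_conflict_iff[symmetric] inj_on_def by blast
  ultimately show ?thesis unfolding discrete_vector_field_def by blast
qed

text \<open>
  A finite graph is a forest iff it admits such a function, for instance the distance to a root in
  each component.
\<close>

definition forest_height :: "'a set set \<Rightarrow> ('a \<Rightarrow> 'b::linorder) \<Rightarrow> bool" where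
  "forest_height G d \<longleftrightarrow>
     (\<forall>v w w'. (v, w) \<in> arcs G \<and> (v, w') \<in> arcs G \<and> d w \<le> d v \<and> d w' \<le> d v \<longrightarrow> w = w')"

lemma closed_V_path_unroll:
  assumes V: "discrete_vector_field G V" and path: "V_path V vs es"
    and nontrivial: "1 \<le> length es" and closed: "last vs = hd vs"
  obtains f where "finite (range f)" "\<And>i. (f i, f (Suc i)) \<in> arcs G"
    "\<And>i. (f i, {f i, f (Suc i)}) \<in> V" "\<And>i. f (i + length es) = f i"
proof -
  define k where "k = length es"
  have k: "0 < k" using nontrivial unfolding k_def by linarith
  have V_path: "length vs = Suc k"
    "\<And>i. i < k \<Longrightarrow> (vs ! i, es ! i) \<in> V \<and> vs ! Suc i \<in> es ! i \<and> vs ! Suc i \<noteq> vs ! i"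
    using path unfolding V_path_def k_def by blast+
  define f where "f i = vs ! (i mod k)" for i
  have "vs \<noteq> []" using V_path(1) by auto
  then have "vs ! k = vs ! 0" using closed V_path(1) by (simp add: last_conv_nth hd_conv_nth)
  then have f_Suc: "f (Suc i) = vs ! Suc (i mod k)" for i
    by (simp add: f_def mod_Suc)
  have step: "(f i, es ! (i mod k)) \<in> V \<and> f (Suc i) \<in> es ! (i mod k) \<and> f (Suc i) \<noteq> f i" for i
    using V_path(2)[OF mod_less_divisor[OF k, of i]] unfolding f_Suc by (simp add: f_def)
  have edge: "{f i, f (Suc i)} \<in> edges G \<and> (f i, {f i, f (Suc i)}) \<in> V" for i
  proof -
    have es_edge: "es ! (i mod k) \<in> edges G" "f i \<in> es ! (i mod k)"
      using V step[of i] by (auto simp: discrete_vector_field_def)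
    then obtain a b where "es ! (i mod k) = {a, b}" by (auto simp: edges_def card_2_iff)
    then have "es ! (i mod k) = {f i, f (Suc i)}" using es_edge(2) step[of i] by auto
    then show ?thesis using es_edge(1) step[of i] by simp
  qed
  show thesis
  proof (rule that)
    show "finite (range f)"
    proof (rule finite_subset)
      show "range f \<subseteq> (!) vs ` {..<k}" using k by (auto simp: f_def)
    qed simp
    show "(f i, f (Suc i)) \<in> arcs G" for i using edge[of i] by (simp add: arcs_def)
    show "(f i, {f i, f (Suc i)}) \<in> V" for i using edge by blast
    show "f (i + length es) = f i" for i by (simp add: f_def k_def)
  qed
qed

text \<open>
  Both neighbours in a closed path of a vertex of maximal height are its only neighbour that is not
  higher, so that the path enters and leaves this vertex through the same edge.
\<close>

lemma no_closed_V_path: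
  assumes height: "forest_height G d" and V: "discrete_vector_field G V"
    and path: "V_path V vs es" "1 \<le> length es" "last vs = hd vs"
  shows False
proof (rule closed_V_path_unroll[OF V path])
  fix f
  assume range: "finite (range f)" and arc: "\<And>i. (f i, f (Suc i)) \<in> arcs G"
    and pair: "\<And>i. (f i, {f i, f (Suc i)}) \<in> V" and periodic: "\<And>i. f (i + length es) = f i"
  have "Max (d ` range f) \<in> d ` range f" using range by (intro Max_in) auto
  then obtain i where i: "d (f i) = Max (d ` range f)" by auto
  define j where "j = i + length es - 1"
  have "Suc j = i + length es" using path(2) by (simp add: j_def)
  then have "f (Suc j) = f i" using periodic by simp
  then have max: "d (f k) \<le> d (f (Suc j))" for k using i range by simp
  have "(f (Suc j), f j) \<in> arcs G" using arc[of j] by (simp add: arcs_commute)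
  then have "f j = f (Suc (Suc j))"
    using height arc[of "Suc j"] max unfolding forest_height_def by blast
  then have "(f j, {f j, f (Suc j)}) \<in> V" "(f (Suc j), {f j, f (Suc j)}) \<in> V"
    using pair[of j] pair[of "Suc j"] by (simp_all add: insert_commute)
  moreover have "inj_on snd V" using V by (simp add: discrete_vector_field_def)
  ultimately have "f j = f (Suc j)" by (metis Pair_inject inj_onD snd_conv)
  then show False using arc[of j] by (simp add: arcs_irrefl)
qed

lemma gradient_vector_field_forest_iff:
  "forest_height G d \<Longrightarrow> gradient_vector_field G V \<longleftrightarrow> discrete_vector_field G V"
  unfolding gradient_vector_field_def by (blast dest: no_closed_V_path)

lemma primitive_gradient_vector_field_forest_iff:
  assumes G: "abstract_complex G" and height: "forest_height G d"
  shows "primitive_gradient_vector_field G V \<longleftrightarrow> V \<in> arc_field ` arcs G"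
proof
  assume "primitive_gradient_vector_field G V"
  then obtain v e where V: "V = {(v, e)}" "discrete_vector_field G {(v, e)}"
    unfolding primitive_gradient_vector_field_def gradient_vector_field_def by blast
  then have "(v, e) \<in> arc_pair ` arcs G"
    unfolding arc_pair_image_arcs by (simp add: discrete_vector_field_def)
  then show "V \<in> arc_field ` arcs G" using V(1) by (auto simp: arc_field_def)
next
  assume "V \<in> arc_field ` arcs G"
  then obtain a where a: "a \<in> arcs G" "V = {arc_pair a}" by (auto simp: arc_field_def)
  then have "gradient_vector_field G V"
    using discrete_vector_field_arc_pair_iff[OF G, of "{a}"]
    by (simp add: gradient_vector_field_forest_iff[OF height] arc_conflict_def)
  then show "primitive_gradient_vector_field G V"
    unfolding primitive_gradient_vector_field_def using a(2) by (cases "arc_pair a") simp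
qed

lemma arc_field_image_in_morse_complex_iff:
  assumes G: "abstract_complex G" and height: "forest_height G d" and A: "A \<subseteq> arcs G"
  shows "arc_field ` A \<in> morse_complex G \<longleftrightarrow> A \<in> independence_complex (arcs G) arc_conflict"
proof -
  have "finite (arc_field ` A) \<longleftrightarrow> finite A"
    by (rule finite_image_iff[OF inj_on_subset[OF inj_arc_field subset_UNIV]])
  moreover have "\<Union>(arc_field ` A) = arc_pair ` A" by (auto simp: arc_field_def)
  moreover have "\<forall>V\<in>arc_field ` A. V \<in> arc_field ` arcs G" using A by blast
  ultimately show ?thesis
    using A discrete_vector_field_arc_pair_iff[OF G A]
    by (simp add: morse_complex_def independence_complex_def
        primitive_gradient_vector_field_forest_iff[OF G height]
        gradient_vector_field_forest_iff[OF height])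
qed

lemma morse_complex_forest:
  assumes "abstract_complex G" "forest_height G d"
  shows "morse_complex G = image arc_field ` independence_complex (arcs G) arc_conflict"
proof (intro equalityI subsetI)
  fix S assume S: "S \<in> morse_complex G"
  then have "S \<subseteq> arc_field ` arcs G"
    unfolding morse_complex_def primitive_gradient_vector_field_forest_iff[OF assms] by blast
  then obtain A where "A \<subseteq> arcs G" "S = arc_field ` A" by (auto simp: subset_image_iff)
  then show "S \<in> image arc_field ` independence_complex (arcs G) arc_conflict"
    using S arc_field_image_in_morse_complex_iff[OF assms] by blast
next
  fix S assume "S \<in> image arc_field ` independence_complex (arcs G) arc_conflict"
  then obtain A where A: "A \<in> independence_complex (arcs G) arc_conflict" "S = arc_field ` A"
    by blast
  then have "A \<subseteq> arcs G" by (simp add: independence_complex_def)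
  then show "S \<in> morse_complex G"
    using A arc_field_image_in_morse_complex_iff[OF assms] by blast
qed

lemma morse_complex_forest_homeomorphic:
  assumes "abstract_complex G" "forest_height G d"
  shows "geometric_realization (morse_complex G)
           homeomorphic_space geometric_realization (independence_complex (arcs G) arc_conflict)"
  unfolding morse_complex_forest[OF assms]
  by (intro geometric_realization_image inj_on_subset[OF inj_arc_field] subset_UNIV)

definition leaf_at :: "'a set set \<Rightarrow> 'a \<Rightarrow> 'a \<Rightarrow> bool" where
  "leaf_at G c x \<longleftrightarrow> arcs G `` {x} = {c}"

definition prune :: "('a \<times> 'a) set \<Rightarrow> ('a \<times> 'a) set \<Rightarrow> ('a \<times> 'a) set" where
  "prune L A = {(c, w) \<in> A. \<forall>x. (c, x) \<in> L \<longrightarrow> w = x}"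

lemma arc_conflict_leaf:
  assumes "leaf_at G c x" "b \<in> arcs G" "arc_conflict (x, c) b"
  shows "b = (c, x)"
proof -
  have "snd b = c" if "fst b = x"
    using assms(1,2) that by (cases b) (auto simp: leaf_at_def)
  then have "fst b \<noteq> x" using assms(3) by (metis arc_conflict_def prod.collapse)
  then show ?thesis using assms(3) by (auto simp: arc_conflict_def)
qed

lemma independence_complex_prune:
  assumes G: "finite G" and leaf: "\<And>c x. (c, x) \<in> L \<Longrightarrow> leaf_at G c x"
  shows "geometric_realization (independence_complex (arcs G) arc_conflict)
           homotopy_equivalent_space
         geometric_realization (independence_complex (prune L (arcs G)) arc_conflict)"
proof -
  let ?D = "arcs G - prune L (arcs G)"
  have leaf_arc: "(x, w) \<in> arcs G \<longleftrightarrow> w = c" if "(c, x) \<in> L" for c x w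
    using leaf[OF that] by (auto simp: leaf_at_def)
  have "geometric_realization (independence_complex (arcs G) arc_conflict) homotopy_equivalent_space
           geometric_realization (independence_complex (arcs G - ?D) arc_conflict)"
  proof (rule independence_complex_fold[where rank = "\<lambda>_. 0"])
    show "finite (arcs G)" by (rule finite_arcs[OF G])
    show "symp arc_conflict" by (rule symp_arc_conflict)
    show "?D \<subseteq> arcs G" by blast
    fix a assume "a \<in> ?D"
    then obtain c w x where a: "a = (c, w)" "(c, x) \<in> L" "w \<noteq> x"
      by (auto simp: prune_def)
    have x_arc: "(x, y) \<in> arcs G \<longleftrightarrow> y = c" for y by (rule leaf_arc[OF a(2)])
    have "c = y" if "(x, y) \<in> L" for y
    proof -
      have "(y, x) \<in> arcs G" using leaf_arc[OF that] by simp
      then show ?thesis using x_arc[of y] by (simp add: arcs_commute[of x])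
    qed
    then have "(x, c) \<in> arcs G - ?D" using x_arc by (auto simp: prune_def)
    moreover have "arc_conflict a b" if "b \<in> arcs G" "arc_conflict (x, c) b" for b
      using arc_conflict_leaf[OF leaf[OF a(2)] that] a(1,3) by (simp add: arc_conflict_def)
    ultimately show "\<exists>u\<in>arcs G - ?D. \<forall>b\<in>arcs G. arc_conflict u b \<longrightarrow>
        arc_conflict a b \<or> b \<in> ?D \<and> (0::nat) < 0"
      by blast
  qed
  moreover have "arcs G - ?D = prune L (arcs G)" by (auto simp: prune_def)
  ultimately show ?thesis by simp
qed

lemma independence_complex_two_leaves:
  assumes G: "finite G" and leaves: "leaf_at G c x" "leaf_at G c y" "x \<noteq> y"
  shows "geometric_realization (independence_complex (arcs G) arc_conflict)
           homotopy_equivalent_space discrete_topology {()}"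
proof (rule homotopy_eqv_trans[OF independence_complex_prune[of G "{(c, x)}"]
        independence_complex_isolated])
  show "finite G" by (rule G)
  show "leaf_at G c' x'" if "(c', x') \<in> {(c, x)}" for c' x' using that leaves by simp
  show "finite (prune {(c, x)} (arcs G))"
    by (rule finite_subset[OF _ finite_arcs[OF G]]) (auto simp: prune_def)
  show "symp arc_conflict" by (rule symp_arc_conflict)
  have leaf_arc: "(y, w) \<in> arcs G \<longleftrightarrow> w = c" for w
    using leaves(2) by (auto simp: leaf_at_def)
  have "y \<noteq> c" using leaf_arc[of c] arcs_irrefl[of c G] by auto
  then show "(y, c) \<in> prune {(c, x)} (arcs G)" using leaf_arc by (simp add: prune_def)
  show "\<not> arc_conflict (y, c) b" if "b \<in> prune {(c, x)} (arcs G)" for b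
  proof
    assume "arc_conflict (y, c) b"
    moreover have "b \<in> arcs G" using that by (auto simp: prune_def)
    ultimately have "b = (c, y)" by (intro arc_conflict_leaf[OF leaves(2)])
    then show False using that leaves(3) by (auto simp: prune_def)
  qed
qed

section \<open>A path with an extended star at each end\<close>

text \<open>The star at \<open>v\<^sub>0\<close> is indexed by \<open>False\<close> and the one at \<open>v\<^sub>t\<close> by \<open>True\<close>.\<close>

definition side :: "bool \<Rightarrow> star_vertex \<Rightarrow> wedge_vertex" where
  "side s = (if s then Inr \<circ> Inr else Inr \<circ> Inl)"

definition center :: "nat \<Rightarrow> bool \<Rightarrow> wedge_vertex" where
  "center t s = Inl (if s then t else 0)"

definition wedge_graph :: "nat \<Rightarrow> (bool \<Rightarrow> nat) \<Rightarrow> (bool \<Rightarrow> nat) \<Rightarrow> wedge_vertex set set" where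
  "wedge_graph t m n = path_wedge_stars t (m False) (n False) (m True) (n True)"

inductive wedge_parent :: "nat \<Rightarrow> (bool \<Rightarrow> nat) \<Rightarrow> (bool \<Rightarrow> nat) \<Rightarrow> wedge_vertex \<Rightarrow> wedge_vertex \<Rightarrow> bool"
  for t m n where
  path: "i < t \<Longrightarrow> wedge_parent t m n (Inl i) (Inl (Suc i))"
| leaf: "i < m s \<Longrightarrow> wedge_parent t m n (center t s) (side s (Leaf i))"
| mid: "j < n s \<Longrightarrow> wedge_parent t m n (center t s) (side s (Mid j))"
| tip: "j < n s \<Longrightarrow> wedge_parent t m n (side s (Mid j)) (side s (Tip j))"

lemma side_eq_iff [simp]: "side s x = side s' x' \<longleftrightarrow> s = s' \<and> x = x'"
  by (auto simp: side_def)

lemma side_neq_Inl [simp]: "side s x \<noteq> Inl i" "Inl i \<noteq> side s x"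
  by (auto simp: side_def)

lemma side_neq_center [simp]: "side s x \<noteq> center t s'" "center t s' \<noteq> side s x"
  by (simp_all add: center_def)

lemma center_eq_iff: "0 < t \<Longrightarrow> center t s = center t s' \<longleftrightarrow> s = s'"
  by (cases s; cases s') (simp_all add: center_def)

lemma attach_centers_simps [simp]:
  "attach_centers t (Inl i) = Inl i" "attach_centers t (side s Center) = center t s"
  "x \<noteq> Center \<Longrightarrow> attach_centers t (side s x) = side s x"
  by (auto simp: attach_centers_def side_def center_def)

lemma wedge_graph_eq:
  "wedge_graph t m n =
     image (attach_centers t) `
       (image Inl ` path_graph t \<union> (\<Union>s. image (side s) ` extended_star (m s) (n s)))"
  unfolding wedge_graph_def path_wedge_stars_def disjoint_union3_def UNIV_bool
  by (simp add: side_def Un_assoc)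

lemma wedge_graph_cases:
  assumes "\<sigma> \<in> wedge_graph t m n"
  obtains v where "\<sigma> = {v}" | v w where "\<sigma> = {v, w}" "wedge_parent t m n v w"
proof -
  have "(\<exists>v. \<sigma> = {v}) \<or> (\<exists>v w. \<sigma> = {v, w} \<and> wedge_parent t m n v w)"
    using assms unfolding wedge_graph_eq
  proof (elim imageE UnE UN_E)
    fix \<rho> \<tau> assume "\<sigma> = attach_centers t ` \<tau>" "\<tau> = Inl ` \<rho>" "\<rho> \<in> path_graph t"
    then consider i where "\<sigma> = {Inl i}" | i where "\<sigma> = {Inl i, Inl (Suc i)}" "i < t"
      by (fastforce simp: path_graph_def Suc_le_eq dest: Suc_le_D)
    then show ?thesis by cases (blast intro: wedge_parent.path)+
  next
    fix \<rho> \<tau> s assume "\<sigma> = attach_centers t ` \<tau>" "\<tau> = side s ` \<rho>" "\<rho> \<in> extended_star (m s) (n s)"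
    then have "(\<exists>v. \<sigma> = {v}) \<or> (\<exists>i<m s. \<sigma> = {center t s, side s (Leaf i)})
        \<or> (\<exists>j<n s. \<sigma> = {center t s, side s (Mid j)} \<or> \<sigma> = {side s (Mid j), side s (Tip j)})"
      by (auto simp: extended_star_def)
    then show ?thesis by (blast intro: wedge_parent.intros)
  qed
  then show thesis using that by blast
qed

lemma wedge_parent_simplex:
  assumes "wedge_parent t m n v w"
  shows "{v, w} \<in> wedge_graph t m n"
proof -
  have path_simplex: "attach_centers t ` Inl ` \<rho> \<in> wedge_graph t m n" if "\<rho> \<in> path_graph t" for \<rho>
    using that unfolding wedge_graph_eq by blast
  have star_simplex: "attach_centers t ` side s ` \<rho> \<in> wedge_graph t m n"
    if "\<rho> \<in> extended_star (m s) (n s)" for s \<rho>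
    using that unfolding wedge_graph_eq by blast
  show ?thesis using assms
  proof cases
    case (path i)
    then have "{i, Suc i} \<in> path_graph t" by (auto simp: path_graph_def intro!: exI[of _ "Suc i"])
    from path_simplex[OF this] show ?thesis using path by simp
  next
    case (leaf i s)
    then have "{Center, Leaf i} \<in> extended_star (m s) (n s)" by (auto simp: extended_star_def)
    from star_simplex[OF this] show ?thesis using leaf by simp
  next
    case (mid j s)
    then have "{Center, Mid j} \<in> extended_star (m s) (n s)" by (auto simp: extended_star_def)
    from star_simplex[OF this] show ?thesis using mid by simp
  next
    case (tip j s)
    then have "{Mid j, Tip j} \<in> extended_star (m s) (n s)" by (auto simp: extended_star_def)
    from star_simplex[OF this] show ?thesis using tip by simp
  qed
qed

fun wedge_height :: "nat \<Rightarrow> wedge_vertex \<Rightarrow> nat" where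
  "wedge_height t (Inl i) = i"
| "wedge_height t (Inr x) = (case (case_sum id id x) of Tip _ \<Rightarrow> t + 2 | _ \<Rightarrow> t + 1)"

lemma wedge_height_center_le [simp]: "wedge_height t (center t s) \<le> t"
  by (simp add: center_def)

lemma wedge_height_side [simp]:
  "wedge_height t (side s (Leaf i)) = t + 1"
  "wedge_height t (side s (Mid j)) = t + 1"
  "wedge_height t (side s (Tip j)) = t + 2"
  by (simp_all add: side_def)

lemma wedge_parent_height:
  assumes "wedge_parent t m n v w"
  shows "wedge_height t v < wedge_height t w"
  using assms by cases (auto simp: less_Suc_eq_le)

lemma wedge_parent_unique:
  assumes "wedge_parent t m n v w" "wedge_parent t m n v' w"
  shows "v = v'"
  using assms(1) by cases (use assms(2) in \<open>auto elim!: wedge_parent.cases\<close>)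

lemma arcs_wedge_graph:
  "(v, w) \<in> arcs (wedge_graph t m n) \<longleftrightarrow>
     wedge_parent t m n v w \<or> wedge_parent t m n w v"
proof
  assume "(v, w) \<in> arcs (wedge_graph t m n)"
  then have edge: "{v, w} \<in> wedge_graph t m n" "card {v, w} = 2"
    by (simp_all add: arcs_def edges_def)
  from edge(1) show "wedge_parent t m n v w \<or> wedge_parent t m n w v"
  proof (cases rule: wedge_graph_cases)
    case (1 x)
    then show ?thesis using edge(2) by simp
  next
    case (2 x y)
    then show ?thesis by (auto simp: doubleton_eq_iff)
  qed
next
  assume "wedge_parent t m n v w \<or> wedge_parent t m n w v"
  then have "v \<noteq> w" "{v, w} \<in> wedge_graph t m n"
    using wedge_parent_height wedge_parent_simplex by (metis less_irrefl, metis insert_commute)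
  then show "(v, w) \<in> arcs (wedge_graph t m n)"
    by (simp add: arcs_def edges_def)
qed

lemma forest_height_wedge_graph:
  "forest_height (wedge_graph t m n) (wedge_height t)"
proof -
  have "wedge_parent t m n w v"
    if "wedge_parent t m n v w \<or> wedge_parent t m n w v"
      and "wedge_height t w \<le> wedge_height t v" for v w
    using that wedge_parent_height[of t m n v w] by auto
  then show ?thesis
    unfolding forest_height_def arcs_wedge_graph by (blast intro: wedge_parent_unique)
qed

lemma finite_wedge_graph: "finite (wedge_graph t m n)"
  by (simp add: wedge_graph_def path_wedge_stars_def disjoint_union3_def path_graph_def
      extended_star_def setcompr_eq_image[where P = "\<lambda>i. i \<le> t"])


section \<open>Reduction to disjoint edges and a path\<close>

inductive_set pendant_arcs :: "nat \<Rightarrow> (bool \<Rightarrow> nat) \<Rightarrow> (wedge_vertex \<times> wedge_vertex) set" for t n where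
  leaf: "(center t s, side s (Leaf 0)) \<in> pendant_arcs t n"
| tip: "j < n s \<Longrightarrow> (side s (Mid j), side s (Tip j)) \<in> pendant_arcs t n"

lemma leaf_at_center:
  assumes "i < m s"
  shows "leaf_at (wedge_graph t m n) (center t s) (side s (Leaf i))"
  unfolding leaf_at_def using assms
  by (auto simp: arcs_wedge_graph intro: wedge_parent.leaf elim!: wedge_parent.cases)

lemma leaf_at_mid:
  assumes "j < n s"
  shows "leaf_at (wedge_graph t m n) (side s (Mid j)) (side s (Tip j))"
  unfolding leaf_at_def using assms
  by (auto simp: arcs_wedge_graph intro: wedge_parent.tip elim!: wedge_parent.cases)

lemma
  shows finite_pendant_arcs: "finite (pendant_arcs t n)"
    and card_pendant_arcs: "card (pendant_arcs t n) = n False + n True + 2"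
proof -
  let ?leaf = "\<lambda>s. (center t s, side s (Leaf 0))"
    and ?tip = "\<lambda>(s, j). (side s (Mid j), side s (Tip j))"
  let ?J = "Sigma UNIV (\<lambda>s. {..<n s})"
  have pendant_arcs_eq: "pendant_arcs t n = range ?leaf \<union> ?tip ` ?J"
    by (auto simp: image_iff intro: pendant_arcs.intros elim!: pendant_arcs.cases)
  have "card (pendant_arcs t n) = card (range ?leaf) + card (?tip ` ?J)"
    unfolding pendant_arcs_eq by (rule card_Un_disjoint) auto
  also have "card (range ?leaf) = 2" by (subst card_image) (auto simp: inj_def)
  also have "card (?tip ` ?J) = card ?J" by (rule card_image) (auto simp: inj_on_def)
  also have "card ?J = n False + n True" by (simp add: UNIV_bool)
  finally show "card (pendant_arcs t n) = n False + n True + 2" by simp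
  show "finite (pendant_arcs t n)" unfolding pendant_arcs_eq by simp
qed

definition inner_path_arc :: "nat \<Rightarrow> wedge_vertex \<times> wedge_vertex" where
  "inner_path_arc k = (Inl (Suc (k div 2)), Inl (if even k then k div 2 else k div 2 + 2))"

lemma inner_path_arc_simps:
  "inner_path_arc (2 * i) = (Inl (Suc i), Inl i)"
  "inner_path_arc (Suc (2 * i)) = (Inl (Suc i), Inl (Suc (Suc i)))"
  by (simp_all add: inner_path_arc_def)

lemma inner_path_arc_imageI:
  assumes "Suc i < t"
  shows "(Inl (Suc i), Inl i) \<in> inner_path_arc ` {..<2 * t - 2}"
    and "(Inl (Suc i), Inl (Suc (Suc i))) \<in> inner_path_arc ` {..<2 * t - 2}"
  using assms unfolding inner_path_arc_simps[symmetric] by auto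

lemma inj_inner_path_arc: "inj inner_path_arc"
proof (rule injI)
  fix i j assume "inner_path_arc i = inner_path_arc j"
  then show "i = j"
    by (cases "even i"; cases "even j") (auto simp: inner_path_arc_def elim!: evenE oddE)
qed

lemma arc_conflict_inner_path_arc_iff:
  "arc_conflict (inner_path_arc i) (inner_path_arc j) \<longleftrightarrow> j = Suc i \<or> i = Suc j"
  by (cases "even i"; cases "even j")
     (auto simp: arc_conflict_def inner_path_arc_def elim!: evenE oddE, presburger+)

definition paired_arcs :: "nat \<Rightarrow> (bool \<Rightarrow> nat) \<Rightarrow> (wedge_vertex \<times> wedge_vertex) set" where
  "paired_arcs t n = pendant_arcs t n \<union> (pendant_arcs t n)\<inverse>"

lemma pendant_arcs_parent: "(v, w) \<in> pendant_arcs t n \<Longrightarrow> wedge_parent t (\<lambda>_. 1) n v w"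
  by (auto elim!: pendant_arcs.cases intro: wedge_parent.intros)

lemma inj_on_fst_paired_arcs: "0 < t \<Longrightarrow> inj_on fst (paired_arcs t n)"
  by (auto simp: inj_on_def paired_arcs_def center_eq_iff elim!: pendant_arcs.cases)

lemma paired_arcs_subset: "paired_arcs t n \<subseteq> arcs (wedge_graph t (\<lambda>_. 1) n)"
  by (auto simp: paired_arcs_def arcs_wedge_graph simp del: One_nat_def dest: pendant_arcs_parent)

lemma inner_path_arc_source_neq:
  assumes "i < 2 * t - 2" and "b \<in> paired_arcs t n"
  shows "fst (inner_path_arc i) \<noteq> fst b"
proof -
  have "Suc (i div 2) < t" using assms(1) by linarith
  then show ?thesis
    using assms(2)
    by (cases b) (auto simp: inner_path_arc_def paired_arcs_def center_def
        elim!: pendant_arcs.cases split: if_splits)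
qed

lemma prune_wedge_graph_subset:
  "prune (pendant_arcs t n) (arcs (wedge_graph t (\<lambda>_. 1) n)) \<subseteq>
     inner_path_arc ` {..<2 * t - 2} \<union> paired_arcs t n"
proof
  fix a assume "a \<in> prune (pendant_arcs t n) (arcs (wedge_graph t (\<lambda>_. 1) n))"
  then obtain v w where a: "a = (v, w)"
    and link: "wedge_parent t (\<lambda>_. 1) n v w \<or> wedge_parent t (\<lambda>_. 1) n w v"
    and pruned: "\<And>x. (v, x) \<in> pendant_arcs t n \<Longrightarrow> w = x"
    by (auto simp: prune_def arcs_wedge_graph)
  have center: "w = side s (Leaf 0)" if "v = center t s" for s
    using that by (intro pruned) (simp add: pendant_arcs.leaf)
  from link show "a \<in> inner_path_arc ` {..<2 * t - 2} \<union> paired_arcs t n"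
  proof
    assume "wedge_parent t (\<lambda>_. 1) n v w"
    then show ?thesis
    proof cases
      case (path i)
      then obtain k where "i = Suc k" using center[of False] by (cases i) (auto simp: center_def)
      then show ?thesis using path a by (auto intro: inner_path_arc_imageI)
    next
      case (mid j s)
      then show ?thesis using center[of s] by simp
    qed (use a in \<open>auto simp: paired_arcs_def intro: pendant_arcs.intros\<close>)
  next
    assume "wedge_parent t (\<lambda>_. 1) n w v"
    then show ?thesis
    proof cases
      case (path i)
      then have "Suc i \<noteq> t" using center[of True] by (auto simp: center_def)
      then show ?thesis using path a by (auto intro: inner_path_arc_imageI)
    next
      case (mid j s)
      then have "w = side s (Tip j)" by (intro pruned) (simp add: pendant_arcs.tip)
      then show ?thesis using mid by simp
    qed (use a in \<open>auto simp: paired_arcs_def intro: pendant_arcs.intros\<close>)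
  qed
qed

lemma inner_path_arc_in_arcs:
  assumes "i < 2 * t - 2"
  shows "inner_path_arc i \<in> arcs (wedge_graph t m n)"
proof (cases "even i")
  case True
  then obtain k where "i = 2 * k" by (rule evenE)
  then show ?thesis
    using assms wedge_parent.path[of k t m n] by (simp add: inner_path_arc_simps arcs_wedge_graph)
next
  case False
  then obtain k where "i = 2 * k + 1" by (rule oddE)
  then show ?thesis
    using assms wedge_parent.path[of "Suc k" t m n]
    by (simp add: inner_path_arc_simps arcs_wedge_graph)
qed

lemma prune_wedge_graph:
  assumes "0 < t"
  shows "prune (pendant_arcs t n) (arcs (wedge_graph t (\<lambda>_. 1) n)) =
           inner_path_arc ` {..<2 * t - 2} \<union> paired_arcs t n"
proof (intro equalityI prune_wedge_graph_subset subsetI)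
  fix a assume a: "a \<in> inner_path_arc ` {..<2 * t - 2} \<union> paired_arcs t n"
  have "a \<in> arcs (wedge_graph t (\<lambda>_. 1) n)"
    using a inner_path_arc_in_arcs paired_arcs_subset by blast
  moreover have "snd a = x" if "(fst a, x) \<in> pendant_arcs t n" for x
  proof -
    have x: "(fst a, x) \<in> paired_arcs t n" using that by (simp add: paired_arcs_def)
    then have "a \<in> paired_arcs t n" using a inner_path_arc_source_neq by fastforce
    then have "a = (fst a, x)" using inj_onD[OF inj_on_fst_paired_arcs[OF assms] _ _ x] by simp
    then show ?thesis by (metis snd_conv)
  qed
  ultimately show "a \<in> prune (pendant_arcs t n) (arcs (wedge_graph t (\<lambda>_. 1) n))"
    by (cases a) (simp add: prune_def)
qed

lemma one_regular_paired_arcs: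
  assumes "0 < t"
  shows "one_regular (paired_arcs t n) arc_conflict"
proof (rule one_regular_arc_conflict)
  show "inj_on fst (paired_arcs t n)" by (rule inj_on_fst_paired_arcs[OF assms])
  show "sym (paired_arcs t n)" by (auto simp: sym_def paired_arcs_def)
  show "irrefl (paired_arcs t n)"
    by (auto simp: irrefl_def arcs_irrefl dest: subsetD[OF paired_arcs_subset])
qed

lemma card_paired_arcs: "card (paired_arcs t n) = 2 * (n False + n True + 2)"
proof -
  have "pendant_arcs t n \<inter> (pendant_arcs t n)\<inverse> = {}"
    by (fastforce dest: pendant_arcs_parent wedge_parent_height)
  then show ?thesis
    by (simp add: paired_arcs_def card_Un_disjoint finite_pendant_arcs card_pendant_arcs)
qed

lemma wedge_graph_with_path_component:
  assumes "0 < t"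
  shows "graph_with_path_component (paired_arcs t n) arc_conflict inner_path_arc (2 * t - 2)"
proof
  show "finite (paired_arcs t n)" by (simp add: paired_arcs_def finite_pendant_arcs)
  show "symp arc_conflict" by (rule symp_arc_conflict)
  show "inj_on inner_path_arc {..<2 * t - 2}"
    using inj_inner_path_arc by (rule inj_on_subset) simp
  show "arc_conflict (inner_path_arc i) (inner_path_arc j) \<longleftrightarrow> j = Suc i \<or> i = Suc j" for i j
    by (rule arc_conflict_inner_path_arc_iff)
  fix i assume i: "i < 2 * t - 2"
  show "inner_path_arc i \<notin> paired_arcs t n" using inner_path_arc_source_neq[OF i] by blast
  fix b assume b: "b \<in> paired_arcs t n"
  then have "b \<noteq> prod.swap (inner_path_arc i)"
    by (auto simp: inner_path_arc_def paired_arcs_def elim!: pendant_arcs.cases)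
  then show "\<not> arc_conflict (inner_path_arc i) b"
    using inner_path_arc_source_neq[OF i b] by (simp add: arc_conflict_def)
qed

section \<open>The homotopy type of the Morse complex\<close>

lemma morse_complex_wedge_graph_eqv:
  "geometric_realization (morse_complex (wedge_graph t m n)) homotopy_equivalent_space
     geometric_realization (independence_complex (arcs (wedge_graph t m n)) arc_conflict)"
  using abstract_complex_path_wedge_stars forest_height_wedge_graph unfolding wedge_graph_def
  by (intro homeomorphic_imp_homotopy_equivalent_space morse_complex_forest_homeomorphic)

lemma morse_complex_wedge_graph_eqv_pruned:
  assumes "0 < t"
  shows "geometric_realization (morse_complex (wedge_graph t (\<lambda>_. 1) n)) homotopy_equivalent_space
           geometric_realization
             (independence_complex
               (inner_path_arc ` {..<2 * t - 2} \<union> paired_arcs t n) arc_conflict)"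
proof -
  have "leaf_at (wedge_graph t (\<lambda>_. 1) n) c x" if "(c, x) \<in> pendant_arcs t n" for c x
    using that by cases (auto intro: leaf_at_center leaf_at_mid)
  then show ?thesis
    unfolding prune_wedge_graph[OF assms, symmetric]
    by (intro homotopy_eqv_trans[OF morse_complex_wedge_graph_eqv] independence_complex_prune
        finite_wedge_graph)
qed

lemma morse_complex_wedge_graph_contractible:
  "geometric_realization (morse_complex (wedge_graph (3 * u) (\<lambda>_. 1) n))
     homotopy_equivalent_space discrete_topology {()}"
proof (cases "u = 0")
  case True
  have leaf: "leaf_at (wedge_graph 0 (\<lambda>_. 1) n) (Inl 0) (side s (Leaf 0))" for s
    using leaf_at_center[of 0 "\<lambda>_. 1" s 0 n] by (simp add: center_def)
  have "geometric_realization (independence_complex (arcs (wedge_graph 0 (\<lambda>_. 1) n)) arc_conflict)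
      homotopy_equivalent_space discrete_topology {()}"
    using independence_complex_two_leaves[OF finite_wedge_graph leaf[of False] leaf[of True]]
    by simp
  then show ?thesis
    unfolding True mult_0_right by (rule homotopy_eqv_trans[OF morse_complex_wedge_graph_eqv])
next
  case False
  then have t: "0 < 3 * u" by simp
  interpret graph_with_path_component
    "paired_arcs (3 * u) n" arc_conflict inner_path_arc "2 * (3 * u) - 2"
    by (rule wedge_graph_with_path_component[OF t])
  have "2 * (3 * u) - 2 = 1 + 3 * (2 * u - 1)" using False by simp
  then have "(2 * (3 * u) - 2) mod 3 = 1" by (simp only: mod_mult_self2) simp
  then show ?thesis
    by (intro homotopy_eqv_trans[OF morse_complex_wedge_graph_eqv_pruned[OF t]]
        independence_complex_contractible)
qed

lemma morse_complex_wedge_graph_nsphere: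
  assumes r: "r = 1 \<or> r = 2"
  shows "geometric_realization (morse_complex (wedge_graph (3 * u + r) (\<lambda>_. 1) n))
           homotopy_equivalent_space nsphere (n False + n True + 2 * u + r)"
proof -
  define t where "t = 3 * u + r"
  have t: "0 < t" using r by (auto simp: t_def)
  interpret graph_with_path_component "paired_arcs t n" arc_conflict inner_path_arc "2 * t - 2"
    by (rule wedge_graph_with_path_component[OF t])
  have "2 * t - 2 = 2 * (r - 1) + 3 * (2 * u)" using r by (auto simp: t_def)
  then have "(2 * t - 2) mod 3 = (2 * (r - 1)) mod 3" by (simp only: mod_mult_self2)
  then have "(2 * t - 2) mod 3 \<noteq> 1" using r by auto
  moreover have "(2 * t - 2 + 1) div 3 = 2 * u + r - 1"
    using r by (elim disjE) (simp_all add: t_def)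
  then have "card (paired_arcs t n) + 2 * ((2 * t - 2 + 1) div 3) =
      2 * Suc (n False + n True + 2 * u + r)"
    using r by (simp only: card_paired_arcs) auto
  ultimately show ?thesis
    unfolding t_def[symmetric]
    by (intro homotopy_eqv_trans[OF morse_complex_wedge_graph_eqv_pruned[OF t]]
        independence_complex_nsphere one_regular_paired_arcs[OF t])
qed

theorem theorem4p2:
  fixes t n l u :: nat
  shows "(t = 3 * u \<longrightarrow>
            geometric_realization (morse_complex (path_wedge_stars t 1 n 1 l))
              homotopy_equivalent_space discrete_topology {()}) \<and>
         (t = 3 * u + 1 \<longrightarrow>
            geometric_realization (morse_complex (path_wedge_stars t 1 n 1 l))
              homotopy_equivalent_space nsphere (n + l + 2 * u + 1)) \<and>
         (t = 3 * u + 2 \<longrightarrow>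
            geometric_realization (morse_complex (path_wedge_stars t 1 n 1 l))
              homotopy_equivalent_space nsphere (n + l + 2 * u + 2))"
proof -
  let ?arms = "\<lambda>s. if s then l else n"
  have graph: "path_wedge_stars t 1 n 1 l = wedge_graph t (\<lambda>_. 1) ?arms"
    by (simp add: wedge_graph_def)
  show ?thesis
    unfolding graph
    using morse_complex_wedge_graph_contractible[of u ?arms]
      morse_complex_wedge_graph_nsphere[of 1 u ?arms]
      morse_complex_wedge_graph_nsphere[of 2 u ?arms]
    by simp
qed

end
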